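(* Let $A\in\mathbb{R}^{m\times n}$ with $m\ge n$, let $b\in\mathbb{R}^m$ be nonzero, let $1\le k\le n$, and consider a $k$-step Lanczos bidiagonalization with reorthogonalization (LBRO) of $A$ with starting vector $b$, computed in finite precision arithmetic with roundoff unit $\mathbf{u}$, producing $U_{k+1}$, $V_{k+1}$, $B_k$, $\beta_1$, $\alpha_{k+1}$ with orthogonality levels $\mu_{k+1}<1/2$ and $\nu_{k+1}<1/2$. Then there exist two matrices with orthonormal columns, $\bar U_{k+1}=(\bar u_1,\dots,\bar u_{k+1})\in\mathbb{R}^{m\times(k+1)}$ and $\bar V_{k+1}=(\bar v_1,\dots,\bar v_{k+1})\in\mathbb{R}^{n\times(k+1)}$, a matrix $E\in\mathbb{R}^{m\times n}$ and a vector $\delta_b\in\mathbb{R}^m$ such that, with $\bar V_k=(\bar v_1,\dots,\bar v_k)$, $$\bar U_{k+1}(\beta_1 e_1^{(k+1)})=b+\delta_b,$$ $$(A+E)\bar V_k=\bar U_{k+1}B_k,$$ $$(A+E)^T\bar U_{k+1}=\bar V_kB_k^T+\alpha_{k+1}\bar v_{k+1}(e_{k+1}^{(k+1)})^T,$$ and $$\|\bar U_{k+1}-U_{k+1}\|\le 2\mu_{k+1}+O(\mu_{k+1}^2),\qquad \|\bar V_{k+1}-V_{k+1}\|\le \nu_{k+1}+O(\nu_{k+1}^2),$$ $$\|E\|=O\big(\|A\|\sqrt n\,(k\mathbf{u}+k\nu_{k+1}+\mu_{k+1})\big),\qquad \|\delta_b\|=O(\|b\|\mathbf{u}).$$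
   Context: $\|\cdot\|$ is the vector or matrix 2-norm and $e_i^{(l)}$ is the $i$-th column of the identity matrix $I_l$. The roundoff unit $\mathbf{u}$ is a small positive number. Model of the $k$-step LBRO of $A\in\mathbb{R}^{m\times n}$ ($m\ge n$) with starting vector $b\neq0$ in finite precision arithmetic: it produces real vectors of unit length $u_1,\dots,u_{k+1}\in\mathbb{R}^m$, $v_1,\dots,v_{k+1}\in\mathbb{R}^n$, positive numbers $\alpha_1,\dots,\alpha_{k+1}$, $\beta_1,\dots,\beta_{k+1}$, and arbitrary real reorthogonalization coefficients $\xi_{ji}$ ($1\le j\le i\le k$), $\eta_{ji}$ ($1\le j\le i-1$, $i\le k+1$) (some may be zero), such that $\beta_1u_1=b+\delta_0$ and, with $v_0=0$, $$Av_i=\alpha_iu_i+\beta_{i+1}u_{i+1}+\sum_{j=1}^{i}\xi_{ji}u_j+f_i\quad(1\le i\le k),$$ $$A^Tu_i=\alpha_iv_i+\beta_iv_{i-1}+\sum_{j=1}^{i-1}\eta_{ji}v_j+g_i\quad(1\le i\le k+1),$$ where the rounding error terms satisfy $\|F_k\|=O(\|A\|\mathbf{u})$ for $F_k=(f_1,\dots,f_k)$, $\|G_{k+1}\|=O(\|A\|\mathbf{u})$ for $G_{k+1}=(g_1,\dots,g_{k+1})$, and $\|\delta_0\|=O(\|b\|\mathbf{u})$. Put $U_i=(u_1,\dots,u_i)$, $V_i=(v_1,\dots,v_i)$, and let $B_k\in\mathbb{R}^{(k+1)\times k}$ be the lower bidiagonal matrix with diagonal entries $\alpha_1,\dots,\alpha_k$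 and subdiagonal entries $\beta_2,\dots,\beta_{k+1}$ (entry $(i+1,i)$ equals $\beta_{i+1}$). Orthogonality levels: $\mu_i=\|\mathbf{SUT}(I_i-U_i^TU_i)\|$, $\nu_i=\|\mathbf{SUT}(I_i-V_i^TV_i)\|$, where $\mathbf{SUT}(\cdot)$ denotes the strictly upper triangular part of a matrix. $O$-convention: bounds are to first order in the small quantities $\mathbf{u}$ and the orthogonality levels. If $K$ is a constant such that the assumed rounding error bounds hold with $O(z)$ replaced by $Kz$, then a conclusion $y=O(z)$ means that there are constants $C,\varepsilon_0>0$ depending only on $K$ such that $|y|\le Cz$ whenever $\mathbf{u}$ and the orthogonality levels $\mu_{k+1},\nu_{k+1}$ are at most $\varepsilon_0$. *)

theory Defs
  imports Complex_Main "Jordan_Normal_Form.Matrix"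
begin

text \<open>
  The constants hidden in the \<open>O\<close>-bounds must not depend on the dimensions, so the dimensions have
  to be quantified inside the statement. Matrices and vectors are therefore those with explicit
  carriers (\<open>carrier_mat m n\<close>, \<open>carrier_vec n\<close>), not the ones indexed by finite types.
\<close>

definition vnorm :: "real vec \<Rightarrow> real" where
  "vnorm x = sqrt (x \<bullet> x)"

definition mnorm :: "real mat \<Rightarrow> real" where
  "mnorm M = (SUP x \<in> {x \<in> carrier_vec (dim_col M). vnorm x \<le> 1}. vnorm (M *\<^sub>v x))"

definition SUT :: "real mat \<Rightarrow> real mat" where
  "SUT M = mat (dim_row M) (dim_col M) (\<lambda>(i, j). if i < j then M $$ (i, j) else 0)"

definition orth_level :: "real mat \<Rightarrow> real" where
  "orth_level U = mnorm (SUT (1\<^sub>m (dim_col U) - U\<^sup>T * U))"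

definition orthonormal_cols :: "real mat \<Rightarrow> bool" where
  "orthonormal_cols U \<longleftrightarrow> U\<^sup>T * U = 1\<^sub>m (dim_col U)"

text \<open>
  Sequences of vectors and scalars are indexed from 1 as in the usual description of the algorithm:
  \<open>cols_mat m u i\<close> is the matrix \<open>(u 1, \<dots>, u i)\<close> with \<open>m\<close> rows.
\<close>

definition cols_mat :: "nat \<Rightarrow> (nat \<Rightarrow> real vec) \<Rightarrow> nat \<Rightarrow> real mat" where
  "cols_mat m u i = mat_of_cols m (map u [1..<Suc i])"

text \<open>
  Matrix entries are indexed from 0, so in 0-based column \<open>c\<close> of the bidiagonal matrix the diagonal
  entry is \<open>\<alpha> (c + 1)\<close> and the subdiagonal entry is \<open>\<beta> (c + 2)\<close>.
\<close>

definition bidiag :: "nat \<Rightarrow> (nat \<Rightarrow> real) \<Rightarrow> (nat \<Rightarrow> real) \<Rightarrow> real mat" where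
  "bidiag k \<alpha> \<beta> = mat (k + 1) k
     (\<lambda>(r, c). if r = c then \<alpha> (c + 1) else if r = c + 1 then \<beta> (c + 2) else 0)"

text \<open>
  The model of \<open>k\<close> steps of Lanczos bidiagonalization with reorthogonalization in finite precision:
  \<open>\<xi> j i\<close> and \<open>\<eta> j i\<close> are the reorthogonalization coefficients, \<open>f\<close>, \<open>g\<close> and \<open>\<delta>0\<close> the rounding
  errors. The sizes of the rounding errors are not part of this predicate.
\<close>

definition lbro ::
  "nat \<Rightarrow> nat \<Rightarrow> nat \<Rightarrow> real mat \<Rightarrow> real vec \<Rightarrow>
   (nat \<Rightarrow> real vec) \<Rightarrow> (nat \<Rightarrow> real vec) \<Rightarrow> (nat \<Rightarrow> real) \<Rightarrow> (nat \<Rightarrow> real) \<Rightarrow>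
   (nat \<Rightarrow> nat \<Rightarrow> real) \<Rightarrow> (nat \<Rightarrow> nat \<Rightarrow> real) \<Rightarrow>
   (nat \<Rightarrow> real vec) \<Rightarrow> (nat \<Rightarrow> real vec) \<Rightarrow> real vec \<Rightarrow> bool" where
  "lbro m n k A b u v \<alpha> \<beta> \<xi> \<eta> f g \<delta>0 \<longleftrightarrow>
     (\<forall>i\<in>{1..k + 1}. u i \<in> carrier_vec m \<and> vnorm (u i) = 1) \<and>
     (\<forall>i\<in>{1..k + 1}. v i \<in> carrier_vec n \<and> vnorm (v i) = 1) \<and>
     v 0 = 0\<^sub>v n \<and>
     (\<forall>i\<in>{1..k + 1}. 0 < \<alpha> i \<and> 0 < \<beta> i) \<and>
     (\<forall>i\<in>{1..k}. f i \<in> carrier_vec m) \<and>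
     (\<forall>i\<in>{1..k + 1}. g i \<in> carrier_vec n) \<and>
     \<delta>0 \<in> carrier_vec m \<and>
     \<beta> 1 \<cdot>\<^sub>v u 1 = b + \<delta>0 \<and>
     (\<forall>i\<in>{1..k}. A *\<^sub>v v i =
        \<alpha> i \<cdot>\<^sub>v u i + \<beta> (i + 1) \<cdot>\<^sub>v u (i + 1)
          + finsum_vec TYPE(real) m (\<lambda>j. \<xi> j i \<cdot>\<^sub>v u j) {1..i} + f i) \<and>
     (\<forall>i\<in>{1..k + 1}. A\<^sup>T *\<^sub>v u i =
        \<alpha> i \<cdot>\<^sub>v v i + \<beta> i \<cdot>\<^sub>v v (i - 1)
          + finsum_vec TYPE(real) n (\<lambda>j. \<eta> j i \<cdot>\<^sub>v v j) {1..i - 1} + g i)"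

end

theory Submission
  imports Defs "Jordan_Normal_Form.Determinant" "HOL-Analysis.L2_Norm"
begin

text \<open>
  Replace \<open>U = U\<^bsub>k+1\<^esub>\<close> and \<open>V = V\<^bsub>k+1\<^esub>\<close> by their polar factors. If \<open>X = I - U\<^sup>T U\<close>, the factor
  \<open>R\<close> in \<open>U = Q R\<close> satisfies \<open>\<parallel>R - I\<parallel> \<le> 1 - sqrt (1 - \<parallel>X\<parallel>)\<close>, and \<open>\<parallel>X\<parallel> \<le> 2 \<mu>\<close>, so the distance from
  \<open>U\<close> is \<open>\<mu> + O(\<mu>\<^sup>2)\<close> independently of the dimensions. The error \<open>\<delta>\<^sub>b\<close> may not involve \<open>\<mu>\<close>, so the first
  column of the left factor has to be exactly \<open>u\<^sub>1\<close>; a plane rotation at distance \<open>\<mu> + O(\<mu>\<^sup>2)\<close> from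
  the identity achieves this (whence the \<open>2 \<mu>\<close>) without changing the range of \<open>U\<close>.

  Let \<open>T\<close> be the transpose of \<open>(B\<^sub>k, \<alpha>\<^bsub>k+1\<^esub> e\<^bsub>k+1\<^esub>)\<close>. The two required identities hold for \<open>E = Q W\<^sup>T - Z P\<^sub>k\<^sup>T\<close>
  with \<open>W = P T - A\<^sup>T Q\<close> and \<open>Z = (I - Q Q\<^sup>T) A P\<^sub>k\<close>, where \<open>Q\<close>, \<open>P\<close> are the orthonormal factors. Here \<open>Z\<close> is
  small because \<open>Q\<close> and \<open>U\<close> have the same range, and \<open>W\<close> is small once the matrix \<open>H\<close> of the
  coefficients \<open>\<eta>\<close> is. Evaluating \<open>U\<^sup>T A V\<close> by either recurrence shows that the strictly lower
  triangular \<open>H\<^sup>T\<close> agrees with an upper triangular matrix up to \<open>O(\<parallel>A\<parallel> (\<mu> + \<nu> + rnd))\<close>, so that each column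
  of \<open>H\<^sup>T\<close> is that small; passing from columns to the norm costs the factor \<open>sqrt n\<close>.
\<close>

section \<open>Matrix algebra and norms\<close>

text \<open>The carrier-based rules of the library leave the dimensions as schematic variables in their
  side conditions. With equations between dimensions instead, the simplifier can use them as rewrite rules.\<close>

lemma mult_assoc_dim:
  fixes A :: "real mat"
  shows "dim_col A = dim_row B \<Longrightarrow> dim_col B = dim_row C \<Longrightarrow> A * B * C = A * (B * C)"
  by (rule assoc_mult_mat[of _ "dim_row A" "dim_col A" _ "dim_col B" _ "dim_col C"]) auto

lemma mult_add_dim:
  fixes A :: "real mat"
  shows "dim_col A = dim_row B \<Longrightarrow> dim_row B = dim_row C \<Longrightarrow> dim_col B = dim_col C
    \<Longrightarrow> A * (B + C) = A * B + A * C"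
  by (rule mult_add_distrib_mat[of _ "dim_row A" "dim_col A" _ "dim_col B"]) auto

lemma add_mult_dim:
  fixes A :: "real mat"
  shows "dim_row A = dim_row B \<Longrightarrow> dim_col A = dim_col B \<Longrightarrow> dim_col B = dim_row C
    \<Longrightarrow> (A + B) * C = A * C + B * C"
  by (rule add_mult_distrib_mat[of _ "dim_row A" "dim_col A" _ _ "dim_col C"]) auto

lemma mult_minus_dim:
  fixes A :: "real mat"
  shows "dim_col A = dim_row B \<Longrightarrow> dim_row B = dim_row C \<Longrightarrow> dim_col B = dim_col C
    \<Longrightarrow> A * (B - C) = A * B - A * C"
  by (rule mult_minus_distrib_mat[of _ "dim_row A" "dim_col A" _ "dim_col B"]) auto

lemma minus_mult_dim:
  fixes A :: "real mat"
  shows "dim_row A = dim_row B \<Longrightarrow> dim_col A = dim_col B \<Longrightarrow> dim_col B = dim_row C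
    \<Longrightarrow> (A - B) * C = A * C - B * C"
  by (rule minus_mult_distrib_mat[of _ "dim_row A" "dim_col A" _ _ "dim_col C"]) auto

lemma mult_mat_vec_assoc_dim:
  fixes A :: "real mat"
  shows "dim_col A = dim_row B \<Longrightarrow> dim_col B = dim_vec x \<Longrightarrow> (A * B) *\<^sub>v x = A *\<^sub>v (B *\<^sub>v x)"
  by (rule assoc_mult_mat_vec[of _ "dim_row A" "dim_col A" _ "dim_col B"]) ((intro carrier_matI carrier_vecI)?; simp)+

lemma mat_vec_add_dim:
  fixes A :: "real mat"
  shows "dim_col A = dim_vec x \<Longrightarrow> dim_vec x = dim_vec y \<Longrightarrow> A *\<^sub>v (x + y) = A *\<^sub>v x + A *\<^sub>v y"
  by (rule mult_add_distrib_mat_vec[of _ "dim_row A" "dim_col A"]) ((intro carrier_matI carrier_vecI)?; simp)+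

lemma mat_vec_minus_dim:
  fixes A :: "real mat"
  shows "dim_col A = dim_vec x \<Longrightarrow> dim_vec x = dim_vec y \<Longrightarrow> A *\<^sub>v (x - y) = A *\<^sub>v x - A *\<^sub>v y"
  by (rule mult_minus_distrib_mat_vec[of _ "dim_row A" "dim_col A"]) ((intro carrier_matI carrier_vecI)?; simp)+

lemma add_mat_vec_dim:
  fixes A :: "real mat"
  shows "dim_row A = dim_row B \<Longrightarrow> dim_col A = dim_col B \<Longrightarrow> dim_col B = dim_vec x
    \<Longrightarrow> (A + B) *\<^sub>v x = A *\<^sub>v x + B *\<^sub>v x"
  by (rule add_mult_distrib_mat_vec[of _ "dim_row A" "dim_col A"]) ((intro carrier_matI carrier_vecI)?; simp)+

lemma minus_mat_vec_dim:
  fixes A :: "real mat"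
  shows "dim_row A = dim_row B \<Longrightarrow> dim_col A = dim_col B \<Longrightarrow> dim_col B = dim_vec x
    \<Longrightarrow> (A - B) *\<^sub>v x = A *\<^sub>v x - B *\<^sub>v x"
  by (rule minus_mult_distrib_mat_vec[of _ "dim_row A" "dim_col A"]) ((intro carrier_matI carrier_vecI)?; simp)+

lemma mat_vec_smult_dim:
  fixes A :: "real mat"
  shows "dim_col A = dim_vec x \<Longrightarrow> A *\<^sub>v (c \<cdot>\<^sub>v x) = c \<cdot>\<^sub>v (A *\<^sub>v x)"
  by (intro eq_vecI) (simp_all add: scalar_prod_def sum_distrib_left mult.left_commute)

lemma smult_mat_vec_dim:
  fixes A :: "real mat"
  shows "dim_col A = dim_vec x \<Longrightarrow> (c \<cdot>\<^sub>m A) *\<^sub>v x = c \<cdot>\<^sub>v (A *\<^sub>v x)"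
  by (intro eq_vecI) (auto simp: scalar_prod_def sum_distrib_left mult.assoc)

lemma one_mat_vec_dim: "dim_vec x = n \<Longrightarrow> 1\<^sub>m n *\<^sub>v (x :: real vec) = x"
  by (rule one_mult_mat_vec) ((intro carrier_matI carrier_vecI)?; simp)+

lemma one_mult_dim: "dim_row A = n \<Longrightarrow> 1\<^sub>m n * (A :: real mat) = A"
  by (rule left_mult_one_mat[of _ _ "dim_col A"]) auto

lemma mult_one_dim: "dim_col A = n \<Longrightarrow> (A :: real mat) * 1\<^sub>m n = A"
  by (rule right_mult_one_mat[of _ "dim_row A"]) auto

lemma transpose_mult_dim:
  fixes A :: "real mat"
  shows "dim_col A = dim_row B \<Longrightarrow> (A * B)\<^sup>T = B\<^sup>T * A\<^sup>T"
  by (rule transpose_mult[of _ "dim_row A" "dim_col A" _ "dim_col B"]) auto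

lemma transpose_minus_dim:
  fixes A :: "real mat"
  shows "dim_row A = dim_row B \<Longrightarrow> dim_col A = dim_col B \<Longrightarrow> (A - B)\<^sup>T = A\<^sup>T - B\<^sup>T"
  by (rule eq_matI) auto

lemma transpose_add_dim:
  fixes A :: "real mat"
  shows "dim_row A = dim_row B \<Longrightarrow> dim_col A = dim_col B \<Longrightarrow> (A + B)\<^sup>T = A\<^sup>T + B\<^sup>T"
  by (rule eq_matI) auto

lemma scalar_prod_comm_dim: "dim_vec x = dim_vec y \<Longrightarrow> x \<bullet> y = y \<bullet> (x :: real vec)"
  by (rule comm_scalar_prod[of _ "dim_vec y"]) (intro carrier_vecI; simp)+

lemma scalar_prod_transpose:
  fixes A :: "real mat"
  assumes "dim_col A = dim_vec x" "dim_row A = dim_vec y"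
  shows "(A *\<^sub>v x) \<bullet> y = x \<bullet> (A\<^sup>T *\<^sub>v y)"
proof -
  have "(A\<^sup>T *\<^sub>v y) \<bullet> x = y \<bullet> (A *\<^sub>v x)"
    by (rule transpose_vec_mult_scalar[of _ "dim_row A" "dim_col A"])
      ((intro carrier_matI carrier_vecI)?; simp add: assms)+
  then show ?thesis
    using assms scalar_prod_comm_dim[of "A *\<^sub>v x" y] scalar_prod_comm_dim[of x "A\<^sup>T *\<^sub>v y"] by simp
qed

section \<open>The Euclidean norm of vectors\<close>

lemma vnorm_L2: "vnorm x = L2_set (\<lambda>i. x $ i) {0..<dim_vec x}"
  by (simp add: vnorm_def L2_set_def scalar_prod_def power2_eq_square)

lemma vnorm_nonneg [simp]: "0 \<le> vnorm x"
  by (simp add: vnorm_L2)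

lemma vnorm_sq: "(vnorm x)\<^sup>2 = x \<bullet> x"
  by (simp add: vnorm_def scalar_prod_def sum_nonneg)

lemma vnorm_zero [simp]: "vnorm (0\<^sub>v n) = 0"
  by (simp add: vnorm_def scalar_prod_def)

lemma vnorm_eq_0: "vnorm x = 0 \<Longrightarrow> x = 0\<^sub>v (dim_vec x)"
  by (intro eq_vecI) (auto simp: vnorm_L2 L2_set_eq_0_iff)

lemma vnorm_triangle: "dim_vec x = dim_vec y \<Longrightarrow> vnorm (x + y) \<le> vnorm x + vnorm y"
proof -
  assume d: "dim_vec x = dim_vec y"
  have "vnorm (x + y) = L2_set (\<lambda>i. x $ i + y $ i) {0..<dim_vec y}"
    unfolding vnorm_L2 by (rule L2_set_cong) auto
  also have "\<dots> \<le> vnorm x + vnorm y"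
    unfolding vnorm_L2 d by (rule L2_set_triangle_ineq)
  finally show ?thesis .
qed

lemma vnorm_smult: "vnorm (c \<cdot>\<^sub>v x) = \<bar>c\<bar> * vnorm x"
proof -
  have "(c \<cdot>\<^sub>v x) \<bullet> (c \<cdot>\<^sub>v x) = c\<^sup>2 * (x \<bullet> x)"
    by (simp add: scalar_prod_def sum_distrib_left power2_eq_square algebra_simps)
  then show ?thesis by (simp add: vnorm_def real_sqrt_mult)
qed

lemma vnorm_triangle_minus: "dim_vec x = dim_vec y \<Longrightarrow> vnorm (x - y) \<le> vnorm x + vnorm y"
proof -
  assume d: "dim_vec x = dim_vec y"
  have "x - y = x + (-1) \<cdot>\<^sub>v y" by (intro eq_vecI) (auto simp: d)
  then show ?thesis using vnorm_triangle[of x "(-1) \<cdot>\<^sub>v y"] d by (simp add: vnorm_smult)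
qed

lemma vnorm_triangle_lower: "dim_vec x = dim_vec y \<Longrightarrow> vnorm x - vnorm y \<le> vnorm (x - y)"
proof -
  assume d: "dim_vec x = dim_vec y"
  have "x = (x - y) + y" by (intro eq_vecI) (auto simp: d)
  then show ?thesis using vnorm_triangle[of "x - y" y] d by simp
qed

lemma vnorm_cauchy: "dim_vec x = dim_vec y \<Longrightarrow> \<bar>x \<bullet> y\<bar> \<le> vnorm x * vnorm y"
proof -
  assume d: "dim_vec x = dim_vec y"
  have "\<bar>x \<bullet> y\<bar> \<le> (\<Sum>i = 0..<dim_vec y. \<bar>x $ i\<bar> * \<bar>y $ i\<bar>)"
    unfolding scalar_prod_def abs_mult[symmetric] by (rule sum_abs)
  also have "\<dots> \<le> L2_set (\<lambda>i. x $ i) {0..<dim_vec y} * L2_set (\<lambda>i. y $ i) {0..<dim_vec y}"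
    by (rule L2_set_mult_ineq)
  finally show ?thesis unfolding vnorm_L2 d .
qed

lemma index_le_vnorm:
  assumes "i < dim_vec x"
  shows "\<bar>x $ i\<bar> \<le> vnorm x"
proof -
  have "\<bar>x $ i\<bar>\<^sup>2 \<le> (\<Sum>j = 0..<dim_vec x. (x $ j)\<^sup>2)"
    using assms by (simp add: member_le_sum[of i _ "\<lambda>j. (x $ j)\<^sup>2"])
  then show ?thesis unfolding vnorm_L2 L2_set_def by (rule real_le_rsqrt)
qed

section \<open>The operator norm\<close>

lemma mat_vec_bound_exists:
  "\<exists>c\<ge>0. \<forall>x. dim_vec x = dim_col M \<longrightarrow> vnorm (M *\<^sub>v x) \<le> c * vnorm x"
proof (intro exI conjI allI impI)
  show "0 \<le> (\<Sum>i = 0..<dim_row M. vnorm (row M i))" by (simp add: sum_nonneg)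
  fix x :: "real vec" assume x: "dim_vec x = dim_col M"
  have "vnorm (M *\<^sub>v x) \<le> (\<Sum>i = 0..<dim_row M. \<bar>(M *\<^sub>v x) $ i\<bar>)"
    unfolding vnorm_L2 dim_mult_mat_vec by (rule L2_set_le_sum_abs)
  also have "\<dots> \<le> (\<Sum>i = 0..<dim_row M. vnorm (row M i) * vnorm x)"
    by (intro sum_mono) (simp add: vnorm_cauchy x)
  finally show "vnorm (M *\<^sub>v x) \<le> (\<Sum>i = 0..<dim_row M. vnorm (row M i)) * vnorm x"
    by (simp add: sum_distrib_right)
qed

text \<open>The crude bound by the sum of the row norms suffices here: the supremum defining
  \<open>mnorm\<close> is known to be an upper bound only once the set is bounded.\<close>

lemma mnorm_bdd_above:
  "bdd_above ((\<lambda>x. vnorm (M *\<^sub>v x)) ` {x \<in> carrier_vec (dim_col M). vnorm x \<le> 1})"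
proof -
  obtain c where c: "c \<ge> 0" "\<And>x. dim_vec x = dim_col M \<Longrightarrow> vnorm (M *\<^sub>v x) \<le> c * vnorm x"
    using mat_vec_bound_exists by metis
  show ?thesis
  proof (rule bdd_aboveI2)
    fix x assume x: "x \<in> {x \<in> carrier_vec (dim_col M). vnorm x \<le> 1}"
    then have "vnorm (M *\<^sub>v x) \<le> c * vnorm x" by (intro c carrier_vecD) blast
    also have "\<dots> \<le> c * 1" using x c(1) by (intro mult_left_mono) auto
    finally show "vnorm (M *\<^sub>v x) \<le> c" by simp
  qed
qed

lemma mat_vec_zero: "M *\<^sub>v 0\<^sub>v (dim_col M) = (0\<^sub>v (dim_row M) :: real vec)"
  by (intro eq_vecI) auto

lemma mnorm_nonneg [simp]: "0 \<le> mnorm M"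
proof -
  have "vnorm (M *\<^sub>v 0\<^sub>v (dim_col M)) \<le> mnorm M"
    unfolding mnorm_def by (rule cSUP_upper[OF _ mnorm_bdd_above]) simp
  then show ?thesis by (simp add: mat_vec_zero)
qed

lemma mnorm_mult_vec:
  assumes "dim_vec x = dim_col M"
  shows "vnorm (M *\<^sub>v x) \<le> mnorm M * vnorm x"
proof (cases "vnorm x = 0")
  case True
  then show ?thesis using vnorm_eq_0[OF True] assms mat_vec_zero[of M] by simp
next
  case False
  then have pos: "0 < vnorm x" using vnorm_nonneg[of x] by linarith
  have "vnorm (M *\<^sub>v ((1 / vnorm x) \<cdot>\<^sub>v x)) \<le> mnorm M"
    unfolding mnorm_def
    by (rule cSUP_upper[OF _ mnorm_bdd_above], intro CollectI conjI carrier_vecI)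
      (use pos assms in \<open>simp_all add: vnorm_smult\<close>)
  then show ?thesis using pos assms by (simp add: mat_vec_smult_dim vnorm_smult field_simps)
qed

lemma mnorm_leI:
  assumes "0 \<le> c" "\<And>x. dim_vec x = dim_col M \<Longrightarrow> vnorm (M *\<^sub>v x) \<le> c * vnorm x"
  shows "mnorm M \<le> c"
  unfolding mnorm_def
proof (rule cSUP_least)
  have "0\<^sub>v (dim_col M) \<in> {x \<in> carrier_vec (dim_col M). vnorm x \<le> 1}" by simp
  then show "{x \<in> carrier_vec (dim_col M). vnorm x \<le> 1} \<noteq> {}" by blast
  fix x assume x: "x \<in> {x \<in> carrier_vec (dim_col M). vnorm x \<le> 1}"
  then have "vnorm (M *\<^sub>v x) \<le> c * vnorm x" by (intro assms(2) carrier_vecD) blast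
  also have "\<dots> \<le> c * 1" using x assms(1) by (intro mult_left_mono) auto
  finally show "vnorm (M *\<^sub>v x) \<le> c" by simp
qed

text \<open>This and the following estimates take arbitrary bounds as hypotheses, so that the norm
  of a compound expression can be estimated factor by factor by backward chaining.\<close>

lemma mnorm_mult_vec_le:
  assumes "dim_vec x = dim_col M" "mnorm M \<le> c" "vnorm x \<le> d"
  shows "vnorm (M *\<^sub>v x) \<le> c * d"
  by (rule order_trans[OF mnorm_mult_vec[OF assms(1)] mult_mono[OF assms(2,3)]])
    (simp_all add: order_trans[OF mnorm_nonneg assms(2)])

lemma mnorm_mult_le:
  assumes "dim_col M = dim_row N" "mnorm M \<le> c" "mnorm N \<le> d"
  shows "mnorm (M * N) \<le> c * d"
proof (rule mnorm_leI)
  show "0 \<le> c * d"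
    using assms(2,3) mnorm_nonneg[of M] mnorm_nonneg[of N] by (intro mult_nonneg_nonneg) linarith+
  fix x :: "real vec" assume x: "dim_vec x = dim_col (M * N)"
  have "vnorm (N *\<^sub>v x) \<le> d * vnorm x" by (rule mnorm_mult_vec_le) (use x assms in auto)
  then have "vnorm (M *\<^sub>v (N *\<^sub>v x)) \<le> c * (d * vnorm x)"
    by (intro mnorm_mult_vec_le) (use x assms in auto)
  then show "vnorm (M * N *\<^sub>v x) \<le> c * d * vnorm x"
    using x assms(1) by (simp add: mult_mat_vec_assoc_dim)
qed

lemma mnorm_add_le:
  assumes "dim_row M = dim_row N" "dim_col M = dim_col N" "mnorm M \<le> c" "mnorm N \<le> d"
  shows "mnorm (M + N) \<le> c + d"
proof (rule mnorm_leI)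
  show "0 \<le> c + d" using assms(3,4) mnorm_nonneg[of M] mnorm_nonneg[of N] by linarith
  fix x :: "real vec" assume x: "dim_vec x = dim_col (M + N)"
  have "vnorm (M *\<^sub>v x) \<le> c * vnorm x" "vnorm (N *\<^sub>v x) \<le> d * vnorm x"
    by (rule mnorm_mult_vec_le; use x assms in simp)+
  then show "vnorm ((M + N) *\<^sub>v x) \<le> (c + d) * vnorm x"
    using x assms vnorm_triangle[of "M *\<^sub>v x" "N *\<^sub>v x"] by (simp add: add_mat_vec_dim algebra_simps)
qed

lemma mnorm_smult_le: "mnorm (c \<cdot>\<^sub>m M) \<le> \<bar>c\<bar> * mnorm M"
proof (rule mnorm_leI)
  fix x :: "real vec" assume "dim_vec x = dim_col (c \<cdot>\<^sub>m M)"
  then show "vnorm (c \<cdot>\<^sub>m M *\<^sub>v x) \<le> \<bar>c\<bar> * mnorm M * vnorm x"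
    using mnorm_mult_vec[of x M]
    by (simp add: smult_mat_vec_dim vnorm_smult mult_left_mono mult.assoc)
qed simp

lemma mnorm_minus_le:
  assumes "dim_row M = dim_row N" "dim_col M = dim_col N" "mnorm M \<le> c" "mnorm N \<le> d"
  shows "mnorm (M - N) \<le> c + d"
proof -
  have "M - N = M + (-1) \<cdot>\<^sub>m N" by (rule eq_matI) (use assms in auto)
  moreover have "mnorm ((-1) \<cdot>\<^sub>m N) \<le> d" using mnorm_smult_le[of "-1" N] assms(4) by simp
  ultimately show ?thesis using assms by (simp add: mnorm_add_le)
qed

text \<open>With \<open>?y = M\<^sup>T *\<^sub>v x\<close>, Cauchy-Schwarz bounds
  \<open>?y \<bullet> ?y = (M *\<^sub>v ?y) \<bullet> x\<close> by
  \<open>mnorm M * vnorm ?y * vnorm x\<close>, and one factor \<open>vnorm ?y\<close>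
  cancels.\<close>

lemma mnorm_transpose_le: "mnorm (M\<^sup>T) \<le> mnorm M"
proof (rule mnorm_leI)
  fix x :: "real vec" assume x: "dim_vec x = dim_col (M\<^sup>T)"
  let ?y = "M\<^sup>T *\<^sub>v x"
  have "(vnorm ?y)\<^sup>2 = (M *\<^sub>v ?y) \<bullet> x"
    using x by (simp add: vnorm_sq scalar_prod_transpose)
  also have "\<dots> \<le> vnorm (M *\<^sub>v ?y) * vnorm x"
    using vnorm_cauchy[of "M *\<^sub>v ?y" x] x by simp
  also have "\<dots> \<le> (mnorm M * vnorm ?y) * vnorm x"
    by (intro mult_right_mono mnorm_mult_vec) auto
  finally have "vnorm ?y * vnorm ?y \<le> (mnorm M * vnorm x) * vnorm ?y"
    by (simp add: power2_eq_square mult_ac)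
  then show "vnorm ?y \<le> mnorm M * vnorm x"
    by (cases "vnorm ?y = 0") (auto simp: mult_le_cancel_right order_less_le)
qed simp

lemma mnorm_transpose [simp]: "mnorm (M\<^sup>T) = mnorm M"
  using mnorm_transpose_le[of M] mnorm_transpose_le[of "M\<^sup>T"] by simp

lemma vnorm_unit_vec [simp]: "i < n \<Longrightarrow> vnorm (unit_vec n i) = 1"
  by (simp add: vnorm_def)

lemma mat_unit_vec: "j < dim_col M \<Longrightarrow> M *\<^sub>v unit_vec (dim_col M) j = (col M j :: real vec)"
  by (intro eq_vecI) auto

lemma vnorm_col_le: "j < dim_col M \<Longrightarrow> vnorm (col M j) \<le> mnorm M"
  using mnorm_mult_vec[of "unit_vec (dim_col M) j" M] by (simp add: mat_unit_vec)

lemma entry_le_mnorm: "i < dim_row M \<Longrightarrow> j < dim_col M \<Longrightarrow> \<bar>M $$ (i, j)\<bar> \<le> mnorm M"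
  using index_le_vnorm[of i "col M j"] vnorm_col_le[of j M] by simp

text \<open>Each of the \<open>dim_col M\<close> entries of \<open>M\<^sup>T *\<^sub>v x\<close> is
  the scalar product of \<open>x\<close> with a column of \<open>M\<close>, hence at most
  \<open>c * vnorm x\<close> in modulus. This is the source of the factor \<open>sqrt n\<close> in
  the bound on \<open>E\<close>.\<close>

lemma mnorm_le_sqrt_cols:
  assumes "0 \<le> c" "\<And>j. j < dim_col M \<Longrightarrow> vnorm (col M j) \<le> c"
  shows "mnorm M \<le> sqrt (dim_col M) * c"
proof -
  have "mnorm (M\<^sup>T) \<le> sqrt (dim_col M) * c"
  proof (rule mnorm_leI)
    fix x :: "real vec" assume x: "dim_vec x = dim_col (M\<^sup>T)"
    have "vnorm (M\<^sup>T *\<^sub>v x) \<le> L2_set (\<lambda>_. c * vnorm x) {0..<dim_col M}"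
      unfolding vnorm_L2[of "M\<^sup>T *\<^sub>v x"] L2_set_def dim_mult_mat_vec index_transpose_mat(2)
    proof (intro real_sqrt_le_mono sum_mono)
      fix j assume j: "j \<in> {0..<dim_col M}"
      have "\<bar>(M\<^sup>T *\<^sub>v x) $ j\<bar> \<le> c * vnorm x"
        using j x vnorm_cauchy[of "col M j" x] mult_right_mono[OF assms(2)[of j] vnorm_nonneg[of x]]
        by simp
      then show "((M\<^sup>T *\<^sub>v x) $ j)\<^sup>2 \<le> (c * vnorm x)\<^sup>2"
        by (metis abs_ge_zero power2_abs power_mono)
    qed
    also have "\<dots> = sqrt (dim_col M) * c * vnorm x"
      using assms(1) by (simp add: L2_set_def real_sqrt_mult)
    finally show "vnorm (M\<^sup>T *\<^sub>v x) \<le> sqrt (dim_col M) * c * vnorm x" .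
  qed (use assms(1) in simp)
  then show ?thesis by simp
qed

lemma orthonormal_vnorm:
  assumes "Q\<^sup>T * Q = 1\<^sub>m (dim_col Q)" "dim_vec x = dim_col Q"
  shows "vnorm (Q *\<^sub>v x) = vnorm x"
proof -
  have "(Q *\<^sub>v x) \<bullet> (Q *\<^sub>v x) = x \<bullet> (Q\<^sup>T * Q *\<^sub>v x)"
    using assms(2) by (simp add: scalar_prod_transpose mult_mat_vec_assoc_dim)
  then show ?thesis using assms by (simp add: vnorm_def one_mat_vec_dim)
qed

lemma orthonormal_mnorm: "Q\<^sup>T * Q = 1\<^sub>m (dim_col Q) \<Longrightarrow> mnorm Q \<le> 1"
  by (rule mnorm_leI) (simp_all add: orthonormal_vnorm)

section \<open>Polar factors\<close>

lemma convergent_if_geometric_steps: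
  fixes s :: "nat \<Rightarrow> real"
  assumes "0 \<le> q" "q < 1" "\<And>j. \<bar>s (Suc j) - s j\<bar> \<le> d * q ^ j"
  shows "convergent s"
proof -
  have "summable (\<lambda>j. s (Suc j) - s j)"
    by (rule summable_comparison_test'[of "\<lambda>j. d * q ^ j" 0])
      (use assms in \<open>auto intro!: summable_mult summable_geometric\<close>)
  then have "convergent (\<lambda>n. \<Sum>j<n. s (Suc j) - s j)"
    by (simp add: summable_iff_convergent)
  then have "convergent (\<lambda>n. s n - s 0)" by (simp add: sum_lessThan_telescope)
  then show ?thesis using convergent_add_const_right_iff[of s "- s 0"] by simp
qed

text \<open>The limit of the iteration \<open>Y \<mapsto> (X + Y\<^sup>2) / 2\<close> from \<open>0\<close>, which stays in and contracts
  the ball of radius \<open>1 - sqrt (1 - x)\<close>; \<open>1 - Y\<close> is then a square root of \<open>1 - X\<close>.\<close>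

lemma sqrt_fixed_point:
  assumes X: "X \<in> carrier_mat p p" "X\<^sup>T = X" "mnorm X \<le> x" "x < 1"
  obtains Y where "Y \<in> carrier_mat p p" "Y\<^sup>T = Y" "Y + Y = X + Y * Y" "mnorm Y \<le> 1 - sqrt (1 - x)"
proof -
  define y where "y = 1 - sqrt (1 - x)"
  have x0: "0 \<le> x" using X(3) mnorm_nonneg[of X] by linarith
  have y: "0 \<le> y" "y < 1" using x0 X(4) by (auto simp: y_def)
  have "(sqrt (1 - x))\<^sup>2 = 1 - x" using X(4) by simp
  \<comment> \<open>\<open>y\<close> is the smaller root of \<open>x + y * y = 2 * y\<close>, so the
    iteration maps the ball of radius \<open>y\<close> into itself.\<close>
  then have yx: "x + y * y = 2 * y" by (simp add: y_def power2_eq_square algebra_simps)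
  define step where "step = (\<lambda>Y. (1 / 2) \<cdot>\<^sub>m (X + Y * Y))"
  define Z where "Z = (\<lambda>j. (step ^^ j) (0\<^sub>m p p))"
  have ZS: "Z (Suc j) = (1 / 2) \<cdot>\<^sub>m (X + Z j * Z j)" for j by (simp add: Z_def step_def)
  have dX [simp]: "dim_row X = p" "dim_col X = p" using X(1) by auto
  have dZ [simp]: "dim_row (Z j) = p" "dim_col (Z j) = p" for j
    by (induction j) (simp_all add: ZS, simp_all add: Z_def)
  have symZ: "(Z j)\<^sup>T = Z j" for j
  proof (induction j)
    case 0
    show ?case by (simp add: Z_def)
  next
    case (Suc j)
    have "((1 / 2) \<cdot>\<^sub>m (X + Z j * Z j))\<^sup>T = (1 / 2) \<cdot>\<^sub>m (X + Z j * Z j)\<^sup>T"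
      by (rule eq_matI) auto
    also have "(X + Z j * Z j)\<^sup>T = X + Z j * Z j"
      by (simp add: transpose_add_dim transpose_mult_dim Suc X(2))
    finally show ?case by (simp add: ZS)
  qed
  have bZ: "mnorm (Z j) \<le> y" for j
  proof (induction j)
    case 0
    have "0\<^sub>m p p *\<^sub>v w = 0\<^sub>v p" if "dim_vec w = p" for w :: "real vec"
      using that by (intro eq_vecI) (simp_all add: scalar_prod_def)
    then show ?case by (intro mnorm_leI) (use y in \<open>simp_all add: Z_def\<close>)
  next
    case (Suc j)
    have "mnorm (X + Z j * Z j) \<le> x + y * y"
      by (intro mnorm_add_le mnorm_mult_le Suc X(3)) simp_all
    then show ?case using mnorm_smult_le[of "1 / 2" "X + Z j * Z j"] by (simp add: ZS yx)
  qed
  define d where "d = mnorm (Z 1 - Z 0)"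
  \<comment> \<open>The factors need not commute, so the difference of squares is split with
    \<open>?D\<close> once on the right and once on the left. Half of two terms of norm at most
    \<open>y * mnorm ?D\<close> leaves the contraction factor \<open>y\<close>.\<close>
  have dZd: "mnorm (Z (Suc j) - Z j) \<le> d * y ^ j" for j
  proof (induction j)
    case 0
    show ?case by (simp add: d_def)
  next
    case (Suc j)
    let ?D = "Z (Suc j) - Z j"
    have "Z (Suc j) * ?D + ?D * Z j = Z (Suc j) * Z (Suc j) - Z j * Z j"
      by (simp add: mult_minus_dim minus_mult_dim, rule eq_matI) simp_all
    then have "Z (Suc (Suc j)) - Z (Suc j) = (1 / 2) \<cdot>\<^sub>m (Z (Suc j) * ?D + ?D * Z j)"
      by (simp only:, subst (1 2) ZS, intro eq_matI) (simp_all add: field_simps)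
    moreover have "mnorm (Z (Suc j) * ?D + ?D * Z j) \<le> y * (d * y ^ j) + (d * y ^ j) * y"
      by (intro mnorm_add_le mnorm_mult_le Suc bZ) simp_all
    ultimately show ?case
      using mnorm_smult_le[of "1 / 2" "Z (Suc j) * ?D + ?D * Z j"] by (simp add: mult_ac)
  qed
  \<comment> \<open>Entries are dominated by the operator norm, so they also move in geometric steps
    and the limit can be formed entry by entry.\<close>
  have conv: "convergent (\<lambda>j. Z j $$ (a, b))" if "a < p" "b < p" for a b
  proof (rule convergent_if_geometric_steps[OF y])
    fix j
    have "\<bar>(Z (Suc j) - Z j) $$ (a, b)\<bar> \<le> d * y ^ j"
      by (rule order_trans[OF entry_le_mnorm dZd]) (use that in simp_all)
    then show "\<bar>Z (Suc j) $$ (a, b) - Z j $$ (a, b)\<bar> \<le> d * y ^ j" using that by simp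
  qed
  define L where "L = mat p p (\<lambda>(a, b). lim (\<lambda>j. Z j $$ (a, b)))"
  have dL [simp]: "dim_row L = p" "dim_col L = p" by (simp_all add: L_def)
  have lim: "(\<lambda>j. Z j $$ (a, b)) \<longlonglongrightarrow> L $$ (a, b)" if "a < p" "b < p" for a b
    using conv[OF that] that by (simp add: L_def convergent_LIMSEQ_iff)
  show ?thesis
  proof (rule that)
    show "L \<in> carrier_mat p p" by (simp add: L_def)
    show "L\<^sup>T = L"
    proof (rule eq_matI)
      fix a b assume ab: "a < dim_row L" "b < dim_col L"
      have "Z j $$ (b, a) = Z j $$ (a, b)" for j
        using arg_cong[OF symZ[of j], of "\<lambda>M. M $$ (a, b)"] ab by simp
      then show "L\<^sup>T $$ (a, b) = L $$ (a, b)" using ab by (simp add: L_def)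
    qed simp_all
    show "L + L = X + L * L"
    proof (rule eq_matI)
      fix a b assume ab: "a < dim_row (X + L * L)" "b < dim_col (X + L * L)"
      have "(\<lambda>j. X $$ (a, b) + (\<Sum>c = 0..<p. Z j $$ (a, c) * Z j $$ (c, b)))
          \<longlonglongrightarrow> X $$ (a, b) + (\<Sum>c = 0..<p. L $$ (a, c) * L $$ (c, b))"
        using ab by (intro tendsto_intros lim) simp_all
      moreover have "2 * Z (Suc j) $$ (a, b) = X $$ (a, b) + (\<Sum>c = 0..<p. Z j $$ (a, c) * Z j $$ (c, b))" for j
        using ab by (simp add: ZS scalar_prod_def)
      moreover have "(\<lambda>j. 2 * Z (Suc j) $$ (a, b)) \<longlonglongrightarrow> 2 * L $$ (a, b)"
        using ab by (intro tendsto_intros LIMSEQ_Suc lim) simp_all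
      ultimately have "2 * L $$ (a, b) = X $$ (a, b) + (\<Sum>c = 0..<p. L $$ (a, c) * L $$ (c, b))"
        by (simp add: LIMSEQ_unique)
      then show "(L + L) $$ (a, b) = (X + L * L) $$ (a, b)"
        using ab by (simp add: scalar_prod_def)
    qed simp_all
    show "mnorm L \<le> 1 - sqrt (1 - x)"
      unfolding y_def[symmetric]
    proof (rule mnorm_leI[OF y(1)])
      fix w :: "real vec" assume w: "dim_vec w = dim_col L"
      \<comment> \<open>The bound passes to the limit for each fixed \<open>w\<close>, where only
        finitely many entries are involved; the supremum over \<open>w\<close> comes
        afterwards.\<close>
      have "(\<lambda>j. (\<Sum>a = 0..<p. (\<Sum>b = 0..<p. Z j $$ (a, b) * w $ b)\<^sup>2))
          \<longlonglongrightarrow> (\<Sum>a = 0..<p. (\<Sum>b = 0..<p. L $$ (a, b) * w $ b)\<^sup>2)"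
        by (intro tendsto_intros lim) simp_all
      moreover have "vnorm (M *\<^sub>v w) = sqrt (\<Sum>a = 0..<p. (\<Sum>b = 0..<p. M $$ (a, b) * w $ b)\<^sup>2)"
        if "dim_row M = p" "dim_col M = p" for M
        using w that by (simp add: vnorm_L2 L2_set_def scalar_prod_def)
      ultimately have "(\<lambda>j. vnorm (Z j *\<^sub>v w)) \<longlonglongrightarrow> vnorm (L *\<^sub>v w)"
        by (simp add: tendsto_real_sqrt)
      then show "vnorm (L *\<^sub>v w) \<le> y * vnorm w"
        by (rule LIMSEQ_le_const2) (use w in \<open>auto intro!: mnorm_mult_vec_le bZ\<close>)
    qed
  qed
qed

text \<open>For the fixed point \<open>Y\<close> belonging to \<open>?X\<close>, the matrix
  \<open>R = 1\<^sub>m p - Y\<close> is a symmetric square root of \<open>U\<^sup>T * U\<close>,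
  since \<open>Y + Y - Y * Y = ?X\<close>. It has an inverse \<open>S\<close>, and
  \<open>Q = U * S\<close> is orthonormal because \<open>R * R = U\<^sup>T * U\<close>.\<close>

lemma polar_factor:
  assumes "U \<in> carrier_mat m p" "mnorm (1\<^sub>m p - U\<^sup>T * U) \<le> x" "x < 1"
  obtains Q R where "Q \<in> carrier_mat m p" "R \<in> carrier_mat p p" "Q\<^sup>T * Q = 1\<^sub>m p" "U = Q * R"
    "mnorm (R - 1\<^sub>m p) \<le> 1 - sqrt (1 - x)"
proof -
  let ?X = "1\<^sub>m p - U\<^sup>T * U"
  have dU [simp]: "dim_row U = m" "dim_col U = p" using assms(1) by auto
  have "?X \<in> carrier_mat p p" "?X\<^sup>T = ?X"
    by (simp_all add: carrier_matI transpose_minus_dim transpose_mult_dim)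
  then obtain Y where Y: "Y \<in> carrier_mat p p" "Y\<^sup>T = Y" "Y + Y = ?X + Y * Y" "mnorm Y \<le> 1 - sqrt (1 - x)"
    using sqrt_fixed_point assms(2,3) by metis
  have dY [simp]: "dim_row Y = p" "dim_col Y = p" using Y(1) by auto
  define R where "R = 1\<^sub>m p - Y"
  have dR [simp]: "dim_row R = p" "dim_col R = p" by (simp_all add: R_def)
  have R: "R \<in> carrier_mat p p" by (simp add: carrier_matI)
  have symR: "R\<^sup>T = R" by (simp add: R_def transpose_minus_dim Y(2))
  have RR: "R * R = U\<^sup>T * U"
  proof (rule eq_matI)
    fix i j assume ij: "i < dim_row (U\<^sup>T * U)" "j < dim_col (U\<^sup>T * U)"
    have "R * R = (1\<^sub>m p - Y) - (Y - Y * Y)"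
      by (simp add: R_def minus_mult_dim mult_minus_dim one_mult_dim mult_one_dim)
    moreover have "(Y + Y) $$ (i, j) = (?X + Y * Y) $$ (i, j)" using Y(3) by simp
    ultimately show "(R * R) $$ (i, j) = (U\<^sup>T * U) $$ (i, j)"
      using ij by (simp del: index_mult_mat(1))
  qed simp_all
  have y1: "1 - sqrt (1 - x) < 1" using assms(3) by simp
  \<comment> \<open>A kernel vector \<open>w\<close> of \<open>R\<close> satisfies
    \<open>w = Y *\<^sub>v w\<close>, which forces \<open>w\<close> to vanish because the norm of
    \<open>Y\<close> is below 1.\<close>
  have "det R \<noteq> 0"
  proof
    assume "det R = 0"
    then obtain w where w: "w \<in> carrier_vec p" "w \<noteq> 0\<^sub>v p" "R *\<^sub>v w = 0\<^sub>v p"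
      using det_0_iff_vec_prod_zero[OF R] by blast
    have dw [simp]: "dim_vec w = p" using w(1) by (rule carrier_vecD)
    have "vnorm w - vnorm (Y *\<^sub>v w) \<le> vnorm (w - Y *\<^sub>v w)"
      by (rule vnorm_triangle_lower) simp
    also have "w - Y *\<^sub>v w = R *\<^sub>v w" by (simp add: R_def minus_mat_vec_dim one_mat_vec_dim)
    finally have "vnorm w \<le> vnorm (Y *\<^sub>v w)" by (simp add: w(3))
    also have "\<dots> \<le> (1 - sqrt (1 - x)) * vnorm w" by (intro mnorm_mult_vec_le Y(4)) simp_all
    finally have "sqrt (1 - x) * vnorm w \<le> 0" by (simp add: algebra_simps)
    then have "vnorm w = 0"
      using assms(3) vnorm_nonneg[of w] by (simp add: mult_le_0_iff)
    then show False using vnorm_eq_0 w(2) by fastforce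
  qed
  from det_non_zero_imp_unit[OF R this, of "()"]
  obtain S where S: "S \<in> carrier_mat p p" "S * R = 1\<^sub>m p" "R * S = 1\<^sub>m p"
    by (auto simp: Units_def ring_mat_def)
  have dS [simp]: "dim_row S = p" "dim_col S = p" using S(1) by auto
  show ?thesis
  proof (rule that[of "U * S" R])
    have "(U * S)\<^sup>T * (U * S) = S\<^sup>T * ((U\<^sup>T * U) * S)"
      by (simp add: transpose_mult_dim mult_assoc_dim)
    also have "\<dots> = (S\<^sup>T * R) * (R * S)"
      by (simp add: RR[symmetric] mult_assoc_dim)
    also have "S\<^sup>T * R = (R * S)\<^sup>T" by (simp add: transpose_mult_dim symR)
    finally show "(U * S)\<^sup>T * (U * S) = 1\<^sub>m p" by (simp add: S(3) one_mult_dim)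
    show "U = U * S * R" by (simp add: mult_assoc_dim S(2) mult_one_dim)
    have "R - 1\<^sub>m p = (-1) \<cdot>\<^sub>m Y" by (rule eq_matI) (simp_all add: R_def)
    then show "mnorm (R - 1\<^sub>m p) \<le> 1 - sqrt (1 - x)"
      using mnorm_smult_le[of "-1" Y] Y(4) by simp
  qed (simp_all add: R carrier_matI)
qed

section \<open>Plane rotations and orthonormalization with a prescribed first column\<close>

lemma add_scalar_prod_dim:
  "dim_vec x = dim_vec z \<Longrightarrow> dim_vec y = dim_vec z \<Longrightarrow> (x + y) \<bullet> z = x \<bullet> z + y \<bullet> (z :: real vec)"
  by (rule add_scalar_prod_distrib[of _ "dim_vec z"]) (intro carrier_vecI; simp)+

lemma scalar_prod_add_dim:
  "dim_vec x = dim_vec z \<Longrightarrow> dim_vec y = dim_vec z \<Longrightarrow> x \<bullet> (y + z) = x \<bullet> y + x \<bullet> (z :: real vec)"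
  by (rule scalar_prod_add_distrib[of _ "dim_vec z"]) (intro carrier_vecI; simp)+

lemma smult_scalar_prod_dim: "dim_vec x = dim_vec y \<Longrightarrow> (c \<cdot>\<^sub>v x) \<bullet> y = c * (x \<bullet> (y :: real vec))"
  by (rule smult_scalar_prod_distrib[of _ "dim_vec y"]) (intro carrier_vecI; simp)+

lemma scalar_prod_smult_dim: "dim_vec x = dim_vec y \<Longrightarrow> x \<bullet> (c \<cdot>\<^sub>v y) = c * (x \<bullet> (y :: real vec))"
  by (rule scalar_prod_smult_distrib[of _ "dim_vec y"]) (intro carrier_vecI; simp)+

lemmas scalar_prod_dims =
  add_scalar_prod_dim scalar_prod_add_dim smult_scalar_prod_dim scalar_prod_smult_dim

text \<open>The right side minus the left side is the Gram determinant of \<open>a\<close>,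
  \<open>b\<close>, \<open>x\<close>. For independent \<open>a\<close> and \<open>b\<close> this is
  Bessel's inequality for the plane that they span.\<close>

lemma gram_inequality:
  assumes "dim_vec a = n" "dim_vec b = n" "dim_vec x = n" "vnorm a = 1" "vnorm b = 1"
  shows "(a \<bullet> x)\<^sup>2 + (b \<bullet> x)\<^sup>2 - 2 * (a \<bullet> b) * (a \<bullet> x) * (b \<bullet> x) \<le> (1 - (a \<bullet> b)\<^sup>2) * (x \<bullet> x)"
proof -
  define c p q where "c = a \<bullet> b" "p = a \<bullet> x" "q = b \<bullet> x"
  have prods: "a \<bullet> a = 1" "b \<bullet> b = 1" "b \<bullet> a = c" "a \<bullet> b = c" "x \<bullet> a = p" "x \<bullet> b = q" "a \<bullet> x = p" "b \<bullet> x = q"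
    using assms by (simp_all add: c_p_q_def scalar_prod_comm_dim[of _ a] scalar_prod_comm_dim[of x b] flip: vnorm_sq)
  have c1: "\<bar>c\<bar> \<le> 1" using vnorm_cauchy[of a b] assms by (simp add: c_p_q_def)
  consider "c\<^sup>2 = 1" | "c\<^sup>2 < 1" using c1 by (metis abs_square_le_1 order_le_less)
  then show ?thesis
  proof cases
    case 1
    \<comment> \<open>In this case \<open>a\<close> and \<open>b\<close> are parallel:
      \<open>z\<close> has length zero, so \<open>b\<close> acts on \<open>x\<close> as the multiple
      \<open>c\<close> of \<open>a\<close>.\<close>
    define z where "z = b + (- c) \<cdot>\<^sub>v a"
    have dz: "dim_vec z = n" using assms by (simp add: z_def)
    have "z \<bullet> z = 1 - c\<^sup>2" using assms
      by (simp add: z_def scalar_prod_dims prods power2_eq_square)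
    then have "vnorm z = 0" using 1 by (simp add: vnorm_def)
    then have "\<bar>z \<bullet> x\<bar> \<le> 0" using vnorm_cauchy[of z x] dz assms by simp
    moreover have "z \<bullet> x = q - c * p" using assms by (simp add: z_def scalar_prod_dims prods)
    ultimately have "q = c * p" by simp
    then have "p\<^sup>2 + q\<^sup>2 - 2 * c * p * q = (1 - c\<^sup>2) * p\<^sup>2"
      by (simp add: power2_eq_square algebra_simps)
    then show ?thesis using 1 by (simp add: prods)
  next
    case 2
    \<comment> \<open>\<open>z\<close> is \<open>1 - c\<^sup>2\<close> times the component of
      \<open>x\<close> orthogonal to \<open>a\<close> and \<open>b\<close>. The scaling avoids
      division, and \<open>z \<bullet> z\<close> contains the Gram determinant as a factor.\<close>
    define z where "z = (1 - c\<^sup>2) \<cdot>\<^sub>v x + ((c * q - p) \<cdot>\<^sub>v a + (c * p - q) \<cdot>\<^sub>v b)"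
    have "z \<bullet> z = (1 - c\<^sup>2) * ((1 - c\<^sup>2) * (x \<bullet> x) - (p\<^sup>2 + q\<^sup>2 - 2 * c * p * q))"
      using assms by (simp add: z_def scalar_prod_dims prods, simp add: algebra_simps power2_eq_square)
    moreover have "0 \<le> z \<bullet> z" by (simp flip: vnorm_sq)
    ultimately show ?thesis using 2 by (simp add: prods zero_le_mult_iff)
  qed
qed

text \<open>\<open>Q\<close> sends \<open>x\<close> to \<open>x\<close> minus
  \<open>s * (a \<bullet> x + b \<bullet> x)\<close> times \<open>a + b\<close> plus
  \<open>2 * (a \<bullet> x)\<close> times \<open>b\<close>. It rotates the plane of
  \<open>a\<close> and \<open>b\<close> and fixes its orthogonal complement; only opposite vectors
  have to be excluded. The bound is attained at \<open>a\<close>, where \<open>Q\<close> moves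
  \<open>a\<close> to \<open>b\<close>.\<close>

lemma plane_rotation:
  assumes ab: "dim_vec a = n" "dim_vec b = n" "vnorm a = 1" "vnorm b = 1" and c: "- 1 < a \<bullet> b"
  obtains Q where "Q \<in> carrier_mat n n" "Q\<^sup>T * Q = 1\<^sub>m n" "Q *\<^sub>v a = b" "mnorm (Q - 1\<^sub>m n) \<le> vnorm (b - a)"
proof -
  define c s where "c = a \<bullet> b" "s = 1 / (1 + a \<bullet> b)"
  have s: "s * (1 + c) = 1" using c by (simp add: c_s_def)
  have s_pos: "0 < s" using c by (simp add: c_s_def)
  have prods: "a \<bullet> a = 1" "b \<bullet> b = 1" "b \<bullet> a = c" "a \<bullet> b = c"
    using ab by (simp_all add: c_s_def scalar_prod_comm_dim[of _ a] flip: vnorm_sq)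
  define l k where "l = (\<lambda>x. - s * (a \<bullet> x + b \<bullet> x))" "k = (\<lambda>x. 2 * (a \<bullet> x) - s * (a \<bullet> x + b \<bullet> x))"
  define Q where "Q = mat n n (\<lambda>(i, j). (if i = j then 1 else 0)
    - s * (a $ j + b $ j) * a $ i + (2 * a $ j - s * (a $ j + b $ j)) * b $ i)"
  have dQ [simp]: "dim_row Q = n" "dim_col Q = n" by (simp_all add: Q_def)
  have Qx: "Q *\<^sub>v x = x + (l x \<cdot>\<^sub>v a + k x \<cdot>\<^sub>v b)" if x: "dim_vec x = n" for x
  proof (rule eq_vecI)
    fix i assume "i < dim_vec (x + (l x \<cdot>\<^sub>v a + k x \<cdot>\<^sub>v b))"
    then have i: "i < n" using ab by simp
    have "(Q *\<^sub>v x) $ i = (\<Sum>j = 0..<n. (if i = j then x $ j else 0)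
        + (- s * (a $ j * x $ j + b $ j * x $ j) * a $ i
        + (2 * (a $ j * x $ j) - s * (a $ j * x $ j + b $ j * x $ j)) * b $ i))"
      using i x by (simp add: Q_def scalar_prod_def, intro sum.cong) (auto simp: algebra_simps)
    also have "\<dots> = x $ i + (l x * a $ i + k x * b $ i)"
      using i x by (simp add: sum.distrib sum_subtractf l_k_def scalar_prod_def
          flip: sum_distrib_left sum_distrib_right)
    finally show "(Q *\<^sub>v x) $ i = (x + (l x \<cdot>\<^sub>v a + k x \<cdot>\<^sub>v b)) $ i" using i ab x by simp
  qed (use ab in simp)
  have isom: "(Q *\<^sub>v x) \<bullet> (Q *\<^sub>v y) = x \<bullet> y" if xy: "dim_vec x = n" "dim_vec y = n" for x y
  proof -
    have comm: "x \<bullet> a = a \<bullet> x" "x \<bullet> b = b \<bullet> x" using xy ab by (simp_all add: scalar_prod_comm_dim)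
    have "(Q *\<^sub>v x) \<bullet> (Q *\<^sub>v y) = x \<bullet> y + (l y * (a \<bullet> x) + k y * (b \<bullet> x) + l x * (a \<bullet> y) + k x * (b \<bullet> y)
        + l x * l y + k x * k y + (l x * k y + k x * l y) * c)"
      unfolding Qx[OF xy(1)] Qx[OF xy(2)]
      using xy ab by (simp add: scalar_prod_dims prods comm, simp add: algebra_simps)
    \<comment> \<open>The right side exhibits the factor \<open>s * (1 + c) - 1\<close>, which is
      zero. The equation itself is a polynomial identity, so plain expansion proves it without
      division.\<close>
    also have "l y * (a \<bullet> x) + k y * (b \<bullet> x) + l x * (a \<bullet> y) + k x * (b \<bullet> y)
        + l x * l y + k x * k y + (l x * k y + k x * l y) * c
        = 2 * (s * (1 + c) - 1) * (s * (a \<bullet> x + b \<bullet> x) * (a \<bullet> y + b \<bullet> y)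
          - (a \<bullet> x) * (a \<bullet> y + b \<bullet> y) - (a \<bullet> y) * (a \<bullet> x + b \<bullet> x))"
      unfolding l_k_def by (simp add: algebra_simps)
    also have "\<dots> = 0" using s by simp
    finally show ?thesis by simp
  qed
  show ?thesis
  proof (rule that)
    show "Q \<in> carrier_mat n n" by (simp add: carrier_matI)
    show "Q\<^sup>T * Q = 1\<^sub>m n"
    proof (rule eq_matI)
      fix i j assume "i < dim_row (1\<^sub>m n :: real mat)" "j < dim_col (1\<^sub>m n :: real mat)"
      then have ij: "i < n" "j < n" by simp_all
      then have "(Q\<^sup>T * Q) $$ (i, j) = (Q *\<^sub>v unit_vec (dim_col Q) i) \<bullet> (Q *\<^sub>v unit_vec (dim_col Q) j)"
        using mat_unit_vec[of i Q] mat_unit_vec[of j Q] by simp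
      also have "\<dots> = unit_vec n i \<bullet> unit_vec n j" by (simp add: isom)
      finally show "(Q\<^sup>T * Q) $$ (i, j) = (1\<^sub>m n :: real mat) $$ (i, j)" using ij by simp
    qed simp_all
    have "l a = - 1" "k a = 1" using s by (simp_all add: l_k_def prods)
    then show "Q *\<^sub>v a = b" using ab by (intro eq_vecI) (simp_all add: Qx)
    show "mnorm (Q - 1\<^sub>m n) \<le> vnorm (b - a)"
    proof (rule mnorm_leI)
      fix x :: "real vec" assume "dim_vec x = dim_col (Q - 1\<^sub>m n)"
      then have x: "dim_vec x = n" by simp
      have "(Q - 1\<^sub>m n) *\<^sub>v x = Q *\<^sub>v x - x" by (simp add: minus_mat_vec_dim one_mat_vec_dim x)
      also have "\<dots> = l x \<cdot>\<^sub>v a + k x \<cdot>\<^sub>v b" unfolding Qx[OF x] using x ab by (intro eq_vecI) simp_all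
      finally have "(vnorm ((Q - 1\<^sub>m n) *\<^sub>v x))\<^sup>2 = (l x)\<^sup>2 + (k x)\<^sup>2 + 2 * l x * k x * c"
        unfolding vnorm_sq using x ab by (simp add: scalar_prod_dims prods, simp add: algebra_simps power2_eq_square)
      \<comment> \<open>Again a multiple of \<open>s * (1 + c) - 1\<close> is split off; what
        remains is the quadratic form of \<open>gram_inequality\<close>.\<close>
      also have "\<dots> = s * (2 * ((a \<bullet> x)\<^sup>2 + (b \<bullet> x)\<^sup>2 - 2 * c * (a \<bullet> x) * (b \<bullet> x)))
          + (s * (1 + c) - 1) * (2 * s * (a \<bullet> x + b \<bullet> x)\<^sup>2 - 4 * (a \<bullet> x)\<^sup>2)"
        unfolding l_k_def by (simp add: algebra_simps power2_eq_square)
      also have "\<dots> = s * (2 * ((a \<bullet> x)\<^sup>2 + (b \<bullet> x)\<^sup>2 - 2 * c * (a \<bullet> x) * (b \<bullet> x)))"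
        using s by simp
      also have "\<dots> \<le> s * (2 * ((1 - c\<^sup>2) * (x \<bullet> x)))"
        using gram_inequality[OF ab(1,2) x ab(3,4)] s_pos by (intro mult_left_mono) (auto simp: prods)
      \<comment> \<open>\<open>1 - c\<^sup>2\<close> contains the factor \<open>1 + c\<close>, which
        cancels \<open>s\<close>, and \<open>2 - 2 * c\<close> is the squared distance of the unit
        vectors \<open>a\<close> and \<open>b\<close>.\<close>
      also have "\<dots> = (s * (1 + c)) * ((2 - 2 * c) * (x \<bullet> x))"
        by (simp add: algebra_simps power2_eq_square)
      also have "\<dots> = (2 - 2 * c) * (x \<bullet> x)" using s by simp
      also have "2 - 2 * c = (b + (-1) \<cdot>\<^sub>v a) \<bullet> (b + (-1) \<cdot>\<^sub>v a)" using ab by (simp add: scalar_prod_dims prods)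
      also have "b + (-1) \<cdot>\<^sub>v a = b - a" using ab by (intro eq_vecI) simp_all
      also have "(b - a) \<bullet> (b - a) * (x \<bullet> x) = (vnorm (b - a) * vnorm x)\<^sup>2"
        by (simp add: power_mult_distrib vnorm_sq)
      finally show "vnorm ((Q - 1\<^sub>m n) *\<^sub>v x) \<le> vnorm (b - a) * vnorm x"
        by (rule power2_le_imp_le) simp
    qed simp
  qed
qed

text \<open>The rotation \<open>W\<close> acts on coefficient vectors of length \<open>p\<close>: it
  moves the first unit vector \<open>e\<close> to \<open>r = R *\<^sub>v e\<close>, so
  \<open>P * W\<close> has first column \<open>P *\<^sub>v r\<close>, the first column of
  \<open>U\<close>. Since \<open>r\<close> is within \<open>y\<close> of \<open>e\<close>, the
  rotation adds a second \<open>y\<close> to that of the polar factor.\<close>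

lemma orthonormalize_fixing_first:
  assumes "U \<in> carrier_mat m p" "0 < p" "vnorm (col U 0) = 1" "mnorm (1\<^sub>m p - U\<^sup>T * U) \<le> x" "x < 1"
  obtains Q S where "Q \<in> carrier_mat m p" "S \<in> carrier_mat p p" "Q\<^sup>T * Q = 1\<^sub>m p" "U = Q * S"
    "col Q 0 = col U 0" "mnorm (Q - U) \<le> 2 * (1 - sqrt (1 - x))"
proof -
  define y where "y = 1 - sqrt (1 - x)"
  have y1: "y < 1" using assms(5) by (simp add: y_def)
  obtain P R where PR: "P \<in> carrier_mat m p" "R \<in> carrier_mat p p" "P\<^sup>T * P = 1\<^sub>m p" "U = P * R"
    "mnorm (R - 1\<^sub>m p) \<le> y"
    using polar_factor[OF assms(1,4,5)] unfolding y_def by metis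
  have d [simp]: "dim_row P = m" "dim_col P = p" "dim_row R = p" "dim_col R = p" using PR(1,2) by auto
  define e where "e = (unit_vec p 0 :: real vec)"
  have e: "dim_vec e = p" "vnorm e = 1" using assms(2) by (simp_all add: e_def)
  have Pe: "M *\<^sub>v e = col M 0" if "dim_col M = p" for M
    using mat_unit_vec[of 0 M] that assms(2) by (simp add: e_def)
  define r where "r = R *\<^sub>v e"
  have r: "dim_vec r = p" by (simp add: r_def)
  have Pr: "P *\<^sub>v r = col U 0"
    using Pe[of "P * R"] e by (simp add: r_def PR(4) mult_mat_vec_assoc_dim)
  have nr: "vnorm r = 1" using orthonormal_vnorm[of P r] PR(3) r Pr assms(3) by simp
  have re: "vnorm (r - e) \<le> y"
  proof -
    have "r - e = (R - 1\<^sub>m p) *\<^sub>v e" by (simp add: r_def minus_mat_vec_dim one_mat_vec_dim e)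
    then show ?thesis using mnorm_mult_vec_le[of e "R - 1\<^sub>m p" y 1] PR(5) e by simp
  qed
  \<comment> \<open>\<open>e \<bullet> r\<close> differs from 1 by at most \<open>y\<close>, so it
    is even positive and the rotation exists.\<close>
  have "- 1 < e \<bullet> r"
  proof -
    have "\<bar>e \<bullet> (r - e)\<bar> \<le> y" using vnorm_cauchy[of e "r - e"] re e r by simp
    moreover have "e \<bullet> r = 1 + e \<bullet> (r - e)"
    proof -
      have "r = e + (r - e)" using e r by (intro eq_vecI) auto
      then have "e \<bullet> r = e \<bullet> e + e \<bullet> (r - e)" using scalar_prod_add_dim[of e "r - e" e] e r by simp
      then show ?thesis using e vnorm_sq[of e] by simp
    qed
    ultimately show ?thesis using y1 by linarith
  qed
  then obtain W where W: "W \<in> carrier_mat p p" "W\<^sup>T * W = 1\<^sub>m p" "W *\<^sub>v e = r" "mnorm (W - 1\<^sub>m p) \<le> vnorm (r - e)"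
    using plane_rotation[OF e(1) r e(2) nr] by metis
  have dW [simp]: "dim_row W = p" "dim_col W = p" using W(1) by auto
  have WW: "W * W\<^sup>T = 1\<^sub>m p"
    using mat_mult_left_right_inverse[of "W\<^sup>T" p W] W(1,2) by simp
  show ?thesis
  proof (rule that[of "P * W" "W\<^sup>T * R"])
    have "(P * W)\<^sup>T * (P * W) = W\<^sup>T * ((P\<^sup>T * P) * W)" by (simp add: transpose_mult_dim mult_assoc_dim)
    then show "(P * W)\<^sup>T * (P * W) = 1\<^sub>m p" by (simp add: PR(3) one_mult_dim W(2))
    have "P * W * (W\<^sup>T * R) = P * ((W * W\<^sup>T) * R)" by (simp add: mult_assoc_dim)
    then show "U = P * W * (W\<^sup>T * R)" by (simp add: WW one_mult_dim PR(4))
    show "col (P * W) 0 = col U 0"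
      using Pe[of "P * W"] e by (simp add: mult_mat_vec_assoc_dim W(3) Pr)
    have "P * ((W - 1\<^sub>m p) - (R - 1\<^sub>m p)) = P * W - U"
    proof -
      have "(W - 1\<^sub>m p) - (R - 1\<^sub>m p) = W - R" by (rule eq_matI) auto
      then show ?thesis by (simp add: mult_minus_dim PR(4))
    qed
    moreover have "mnorm (P * ((W - 1\<^sub>m p) - (R - 1\<^sub>m p))) \<le> 1 * (y + y)"
      by (intro mnorm_mult_le mnorm_minus_le orthonormal_mnorm) (use PR(3,5) W(4) re in auto)
    ultimately show "mnorm (P * W - U) \<le> 2 * (1 - sqrt (1 - x))" by (simp add: y_def)
  qed (simp_all add: carrier_matI)
qed

text \<open>The quadratic form of \<open>1 - U\<^sup>T * U\<close> at \<open>x\<close> is the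
  difference of the squared norms of \<open>x\<close> and \<open>U *\<^sub>v x\<close>, so these
  differ by at most half of the former. The first bound recovers the size of coefficients from the
  vector that they represent.\<close>

lemma nearly_orthonormal_vnorm:
  assumes "mnorm (1\<^sub>m (dim_col U) - U\<^sup>T * U) \<le> 1 / 2" "dim_vec x = dim_col U"
  shows "vnorm x \<le> 2 * vnorm (U *\<^sub>v x)" "vnorm (U *\<^sub>v x) \<le> 2 * vnorm x"
proof -
  let ?X = "1\<^sub>m (dim_col U) - U\<^sup>T * U"
  have "\<bar>(?X *\<^sub>v x) \<bullet> x\<bar> \<le> vnorm (?X *\<^sub>v x) * vnorm x" using assms(2) by (intro vnorm_cauchy) simp
  also have "\<dots> \<le> (1 / 2 * vnorm x) * vnorm x"
    by (intro mult_right_mono mnorm_mult_vec_le assms(1)) (use assms(2) in simp_all)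
  also have "(?X *\<^sub>v x) \<bullet> x = (vnorm x)\<^sup>2 - (vnorm (U *\<^sub>v x))\<^sup>2"
  proof -
    have "?X *\<^sub>v x + U\<^sup>T *\<^sub>v (U *\<^sub>v x) = x"
      using assms(2) by (simp add: minus_mat_vec_dim one_mat_vec_dim mult_mat_vec_assoc_dim, intro eq_vecI) simp_all
    then have "x \<bullet> x = (?X *\<^sub>v x) \<bullet> x + (U\<^sup>T *\<^sub>v (U *\<^sub>v x)) \<bullet> x"
      using add_scalar_prod_dim[of "?X *\<^sub>v x" x "U\<^sup>T *\<^sub>v (U *\<^sub>v x)"] assms(2) by simp
    also have "(U\<^sup>T *\<^sub>v (U *\<^sub>v x)) \<bullet> x = (U *\<^sub>v x) \<bullet> (U *\<^sub>v x)"
      using assms(2) by (simp add: scalar_prod_transpose)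
    finally show ?thesis by (simp add: vnorm_sq)
  qed
  finally have *: "\<bar>(vnorm x)\<^sup>2 - (vnorm (U *\<^sub>v x))\<^sup>2\<bar> \<le> (vnorm x)\<^sup>2 / 2" by (simp add: power2_eq_square)
  have "(vnorm x)\<^sup>2 \<le> (2 * vnorm (U *\<^sub>v x))\<^sup>2" "(vnorm (U *\<^sub>v x))\<^sup>2 \<le> (2 * vnorm x)\<^sup>2"
    using * zero_le_power2[of "vnorm x"] zero_le_power2[of "vnorm (U *\<^sub>v x)"]
    unfolding abs_le_iff power_mult_distrib by (simp_all add: field_simps)
  then show "vnorm x \<le> 2 * vnorm (U *\<^sub>v x)" "vnorm (U *\<^sub>v x) \<le> 2 * vnorm x"
    by (auto intro: power2_le_imp_le)
qed

section \<open>The backward error\<close>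

lemma vnorm_mono:
  assumes "dim_vec x = dim_vec y" "\<And>i. i < dim_vec y \<Longrightarrow> \<bar>x $ i\<bar> \<le> \<bar>y $ i\<bar>"
  shows "vnorm x \<le> vnorm y"
  unfolding vnorm_L2 L2_set_def assms(1)
  by (intro real_sqrt_le_mono sum_mono) (simp add: assms(2) flip: abs_le_square_iff)

text \<open>Unit columns make the diagonal of the symmetric matrix \<open>?X\<close> vanish, so it
  is the sum of its strictly upper triangular part and the transpose of that part.\<close>

lemma mnorm_le_orth_level:
  assumes "\<And>j. j < dim_col U \<Longrightarrow> vnorm (col U j) = 1"
  shows "mnorm (1\<^sub>m (dim_col U) - U\<^sup>T * U) \<le> 2 * orth_level U"
proof -
  let ?X = "1\<^sub>m (dim_col U) - U\<^sup>T * U"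
  have "?X = SUT ?X + (SUT ?X)\<^sup>T"
  proof (rule eq_matI)
    fix i j assume "i < dim_row (SUT ?X + (SUT ?X)\<^sup>T)" "j < dim_col (SUT ?X + (SUT ?X)\<^sup>T)"
    then have ij: "i < dim_col U" "j < dim_col U" by (simp_all add: SUT_def)
    then have "col U i \<bullet> col U i = 1" using assms vnorm_sq[of "col U i"] by simp
    then show "?X $$ (i, j) = (SUT ?X + (SUT ?X)\<^sup>T) $$ (i, j)"
      using ij scalar_prod_comm_dim[of "col U i" "col U j"] by (cases i j rule: linorder_cases) (simp_all add: SUT_def)
  qed (simp_all add: SUT_def)
  moreover have "mnorm (SUT ?X + (SUT ?X)\<^sup>T) \<le> orth_level U + orth_level U"
    by (rule mnorm_add_le) (simp_all add: orth_level_def SUT_def)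
  ultimately show ?thesis by simp
qed

text \<open>\<open>1 - 2 * t\<close> exceeds the square of \<open>1 - t - t\<^sup>2\<close> by
  \<open>t\<^sup>2 * (1 - 2 * t - t\<^sup>2)\<close>. The coefficient 1 of the linear term yields
  the leading constants 2 and 1 in the bounds for the two bases.\<close>

lemma one_minus_sqrt_bound:
  assumes "0 \<le> t" "t \<le> 1 / 4"
  shows "1 - sqrt (1 - 2 * t) \<le> t + t\<^sup>2"
proof -
  have "t * t \<le> 1 / 4 * t" using assms by (intro mult_right_mono) auto
  then have "0 \<le> t\<^sup>2 * (1 - 2 * t - t\<^sup>2)"
    using assms by (intro mult_nonneg_nonneg) (auto simp: power2_eq_square)
  then have "(1 - t - t\<^sup>2)\<^sup>2 \<le> 1 - 2 * t" by (simp add: power2_eq_square algebra_simps)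
  then have "1 - t - t\<^sup>2 \<le> sqrt (1 - 2 * t)" by (rule real_le_rsqrt)
  then show ?thesis by simp
qed

text \<open>\<open>J\<close> stands for the first \<open>k\<close> columns of the identity. The
  summand \<open>Q * W\<^sup>T\<close> of \<open>?E\<close> repairs the transposed identity and
  leaves exactly the residual \<open>Z\<close> in the other one. The summand with \<open>Z\<close>
  removes that residual, and because \<open>Q\<^sup>T * Z\<close> vanishes it does not disturb the
  transposed identity.\<close>

lemma backward_error:
  assumes carr: "A \<in> carrier_mat m n" "Q \<in> carrier_mat m p" "P \<in> carrier_mat n p" "T \<in> carrier_mat p p"
      "J \<in> carrier_mat p k"
    and orth: "Q\<^sup>T * Q = 1\<^sub>m p" "P\<^sup>T * P = 1\<^sub>m p" "J\<^sup>T * J = 1\<^sub>m k"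
    and w: "mnorm (P * T - A\<^sup>T * Q) \<le> w"
    and z: "mnorm (A * (P * J) - Q * (Q\<^sup>T * (A * (P * J)))) \<le> z"
  obtains E where "E \<in> carrier_mat m n" "(A + E) * (P * J) = Q * (T\<^sup>T * J)" "(A + E)\<^sup>T * Q = P * T"
    "mnorm E \<le> w + z"
proof
  note [simp] = carr[THEN carrier_matD(1)] carr[THEN carrier_matD(2)]
  define W Z where "W = P * T - A\<^sup>T * Q" and "Z = A * (P * J) - Q * (Q\<^sup>T * (A * (P * J)))"
  have [simp]: "dim_row W = n" "dim_col W = p" "dim_row Z = m" "dim_col Z = k"
    by (simp_all add: W_def Z_def)
  let ?E = "Q * W\<^sup>T - Z * (P * J)\<^sup>T"
  show "?E \<in> carrier_mat m n" by (simp add: carrier_matI)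
  have QQ: "Q\<^sup>T * (Q * X) = X" if "dim_row X = p" for X :: "real mat"
    using that by (simp add: orth(1) one_mult_dim flip: mult_assoc_dim)
  have PP: "P\<^sup>T * (P * X) = X" if "dim_row X = p" for X :: "real mat"
    using that by (simp add: orth(2) one_mult_dim flip: mult_assoc_dim)
  have PJ: "(P * J)\<^sup>T * (P * J) = 1\<^sub>m k"
    by (simp add: transpose_mult_dim mult_assoc_dim PP orth(3))
  have 1: "W\<^sup>T * (P * J) = T\<^sup>T * J - Q\<^sup>T * (A * (P * J))"
    by (simp add: W_def transpose_mult_dim transpose_minus_dim minus_mult_dim mult_assoc_dim PP)
  have "(A + ?E) * (P * J) = A * (P * J) + (Q * (W\<^sup>T * (P * J)) - Z * ((P * J)\<^sup>T * (P * J)))"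
    by (simp only: add_mult_dim minus_mult_dim mult_assoc_dim index_mult_mat index_transpose_mat
        index_minus_mat(2,3) carr[THEN carrier_matD(1)] carr[THEN carrier_matD(2)]
        \<open>dim_row W = n\<close> \<open>dim_col W = p\<close> \<open>dim_row Z = m\<close> \<open>dim_col Z = k\<close>)
  also have "\<dots> = A * (P * J) + (Q * (T\<^sup>T * J) - Q * (Q\<^sup>T * (A * (P * J))) - Z)"
    by (simp add: 1 PJ mult_one_dim mult_minus_dim)
  also have "\<dots> = Q * (T\<^sup>T * J)"
    unfolding Z_def by (rule eq_matI) (simp_all del: index_mult_mat(1))
  finally show "(A + ?E) * (P * J) = Q * (T\<^sup>T * J)" .
  have "Q\<^sup>T * Z = 0\<^sub>m p k"
    by (simp add: Z_def mult_minus_dim QQ) (rule eq_matI; simp del: index_mult_mat(1))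
  then have "Z\<^sup>T * Q = (0\<^sub>m p k)\<^sup>T" by (metis transpose_mult_dim transpose_transpose index_transpose_mat(2,3)
      \<open>dim_row Z = m\<close> carr(2) carrier_matD(1))
  then have 2: "Z\<^sup>T * Q = 0\<^sub>m k p" by simp
  have "(A + ?E)\<^sup>T * Q = A\<^sup>T * Q + (W * (Q\<^sup>T * Q) - (P * J) * (Z\<^sup>T * Q))"
    by (simp add: transpose_add_dim transpose_minus_dim transpose_mult_dim add_mult_dim minus_mult_dim mult_assoc_dim)
  also have "(P * J) * (Z\<^sup>T * Q) = 0\<^sub>m n p"
    unfolding 2 by (rule eq_matI) (simp_all add: scalar_prod_def)
  also have "A\<^sup>T * Q + (W * (Q\<^sup>T * Q) - 0\<^sub>m n p) = P * T"
    unfolding orth(1) by (simp add: mult_one_dim, unfold W_def) (rule eq_matI; simp del: index_mult_mat(1))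
  finally show "(A + ?E)\<^sup>T * Q = P * T" .
  have "mnorm (Q * W\<^sup>T) \<le> 1 * w"
    by (rule mnorm_mult_le) (use w orth(1) orthonormal_mnorm[of Q] in \<open>simp_all add: W_def\<close>)
  moreover have "mnorm (Z * (P * J)\<^sup>T) \<le> z * 1"
    by (rule mnorm_mult_le) (use z PJ orthonormal_mnorm[of "P * J"] in \<open>simp_all add: Z_def\<close>)
  ultimately show "mnorm ?E \<le> w + z" by (intro mnorm_minus_le) simp_all
qed

text \<open>Comparing \<open>U\<^sup>T (A V e\<^sub>j)\<close> with \<open>(A\<^sup>T U)\<^sup>T V e\<^sub>j\<close>: up to small terms the upper triangular part of
  \<open>C\<close> equals the strictly lower triangular \<open>H\<^sup>T\<close> in column \<open>j\<close>, so both are small.\<close>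

lemma reorth_coeff_bound:
  assumes carr: "A \<in> carrier_mat m n" "U \<in> carrier_mat m (k + 1)" "V \<in> carrier_mat n (k + 1)"
      "C \<in> carrier_mat (k + 1) k" "D \<in> carrier_mat (k + 1) (k + 1)" "F \<in> carrier_mat m k"
      "G \<in> carrier_mat n (k + 1)" "H \<in> carrier_mat (k + 1) (k + 1)" "J \<in> carrier_mat (k + 1) k"
    and J: "\<And>j. j < k \<Longrightarrow> col J j = unit_vec (k + 1) j"
    and AV: "A * (V * J) = U * C + F" and AU: "A\<^sup>T * U = V * D + G"
    and H: "\<And>i j. j \<le> k \<Longrightarrow> i \<le> j \<Longrightarrow> H $$ (j, i) = 0"
      "\<And>i j. j < k \<Longrightarrow> j < i \<Longrightarrow> i \<le> k \<Longrightarrow> C $$ (i, j) = D $$ (j, i) - H $$ (j, i)"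
    and XU: "mnorm (1\<^sub>m (k + 1) - U\<^sup>T * U) \<le> 2 * \<mu>" "\<mu> \<le> 1 / 4"
    and XV: "mnorm (1\<^sub>m (k + 1) - V\<^sup>T * V) \<le> 2 * \<nu>" "\<nu> \<le> 1 / 4"
    and FG: "mnorm F \<le> L * mnorm A * r" "mnorm G \<le> L * mnorm A * r" "0 \<le> L" "0 \<le> r" "r \<le> 1 / 4"
  shows "mnorm D \<le> 4 * (mnorm A * (1 + L))"
    and "mnorm H \<le> sqrt (k + 1) * (8 * (mnorm A * (1 + L)) * (\<mu> + \<nu> + r))"
proof -
  note [simp] = carr[THEN carrier_matD(1)] carr[THEN carrier_matD(2)]
  \<comment> \<open>\<open>M\<close> is a common scale for \<open>A\<close> and the rounding errors:
    it exceeds \<open>a\<close> by \<open>a * L\<close>, which dominates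
    \<open>L * a * r\<close>.\<close>
  define a M where "a = mnorm A" and "M = mnorm A * (1 + L)"
  have a0: "0 \<le> a" by (simp add: a_def)
  have aL: "a * L = M - a" and aM: "a \<le> M" using a0 FG(3) by (simp_all add: a_def M_def algebra_simps)
  have r1: "L * a * r \<le> M * r" using aL a0 FG(4) by (intro mult_right_mono) (simp_all add: mult_ac)
  have r2: "L * a * r \<le> M - a"
  proof -
    have "L * a * r \<le> L * a * 1" using FG a0 by (intro mult_left_mono) auto
    also have "\<dots> = M - a" using aL by (simp add: mult.commute)
    finally show ?thesis .
  qed
  have FG': "mnorm F \<le> L * a * r" "mnorm G \<le> L * a * r" using FG by (simp_all add: a_def)
  have nonneg: "0 \<le> \<mu>" "0 \<le> \<nu>"
    using XU(1) XV(1) mnorm_nonneg[of "1\<^sub>m (k + 1) - U\<^sup>T * U"] mnorm_nonneg[of "1\<^sub>m (k + 1) - V\<^sup>T * V"] by linarith+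
  have U: "mnorm (1\<^sub>m (dim_col U) - U\<^sup>T * U) \<le> 1 / 2" and V: "mnorm (1\<^sub>m (dim_col V) - V\<^sup>T * V) \<le> 1 / 2"
    using XU XV by simp_all
  have U2: "mnorm U \<le> 2" and V2: "mnorm V \<le> 2"
    by (rule mnorm_leI, simp, rule nearly_orthonormal_vnorm(2)[OF U], simp,
        rule mnorm_leI, simp, rule nearly_orthonormal_vnorm(2)[OF V], simp)
  show D4: "mnorm D \<le> 4 * (mnorm A * (1 + L))"
    unfolding M_def[symmetric]
  proof (rule mnorm_leI)
    show "0 \<le> 4 * M" using aM a0 by simp
    fix x :: "real vec" assume "dim_vec x = dim_col D"
    then have x: "dim_vec x = k + 1" by simp
    \<comment> \<open>The coefficients \<eta> are arbitrary, so \<open>D\<close> is bounded through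
      \<open>V * D = A\<^sup>T * U - G\<close>, using that \<open>V\<close> shrinks vectors by a
      factor of at most 2.\<close>
    have "mnorm (A\<^sup>T * U - G) \<le> a * 2 + L * a * r"
      by (intro mnorm_minus_le mnorm_mult_le U2 FG') (simp_all add: a_def)
    then have "vnorm ((A\<^sup>T * U - G) *\<^sub>v x) \<le> (a * 2 + L * a * r) * vnorm x"
      by (intro mnorm_mult_vec_le) (simp_all add: x)
    also have "A\<^sup>T * U - G = V * D"
      unfolding AU by (rule eq_matI) (simp_all del: index_mult_mat(1))
    also have "(V * D) *\<^sub>v x = V *\<^sub>v (D *\<^sub>v x)" by (simp add: mult_mat_vec_assoc_dim x)
    finally have "2 * vnorm (V *\<^sub>v (D *\<^sub>v x)) \<le> (2 * (a * 2 + L * a * r)) * vnorm x"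
      by (subst mult.assoc) (rule mult_left_mono, simp_all)
    also have "\<dots> \<le> 4 * M * vnorm x" using r2 aM a0 by (intro mult_right_mono) auto
    finally show "vnorm (D *\<^sub>v x) \<le> 4 * M * vnorm x"
      using nearly_orthonormal_vnorm(1)[OF V, of "D *\<^sub>v x"] by simp
  qed
  have col: "vnorm (col (H\<^sup>T) j) \<le> 8 * M * (\<mu> + \<nu> + r)" if j: "j < k" for j
  proof -
    define e where "e = (unit_vec (k + 1) j :: real vec)"
    define v c f where "v = V *\<^sub>v e" and "c = col C j" and "f = col F j"
    have e: "dim_vec e = k + 1" "vnorm e = 1" using j by (simp_all add: e_def)
    have d [simp]: "dim_vec v = n" "dim_vec c = k + 1" "dim_vec f = m" by (simp_all add: v_def c_def f_def)
    have "col (A * (V * J)) j = A *\<^sub>v (V *\<^sub>v col J j)"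
      using j by (intro eq_vecI) (simp_all add: mult_assoc_dim[symmetric] mult_mat_vec_assoc_dim[symmetric])
    moreover have "col (U * C + F) j = U *\<^sub>v c + f"
      using j by (intro eq_vecI) (simp_all add: c_def f_def)
    ultimately have Av: "A *\<^sub>v v = U *\<^sub>v c + f"
      unfolding AV J[OF j] v_def e_def by simp
    have v2: "vnorm v \<le> 2" unfolding v_def using mnorm_mult_vec_le[OF _ V2, of e 1] e by simp
    have f1: "vnorm f \<le> L * a * r" unfolding f_def by (rule order_trans[OF vnorm_col_le FG'(1)]) (simp add: j)
    \<comment> \<open>The same argument with \<open>U\<close> bounds this column of
      \<open>C\<close>, although the coefficients \<xi> are arbitrary.\<close>
    have c4: "vnorm c \<le> 4 * M"
    proof -
      have "U *\<^sub>v c = A *\<^sub>v v - f" unfolding Av by (intro eq_vecI) simp_all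
      then have "vnorm (U *\<^sub>v c) \<le> a * 2 + L * a * r"
        using vnorm_triangle_minus[of "A *\<^sub>v v" f] mnorm_mult_vec_le[of v A a 2] v2 f1 by (simp add: a_def)
      then show ?thesis using nearly_orthonormal_vnorm(1)[OF U, of c] r2 aM a0 by simp
    qed
    let ?XU = "1\<^sub>m (k + 1) - U\<^sup>T * U" and ?XV = "1\<^sub>m (k + 1) - V\<^sup>T * V"
    \<comment> \<open>\<open>t\<close> turns out to be column \<open>j\<close> of \<open>C\<close>
      minus row \<open>j\<close> of \<open>D\<close>. Each term here contains one small factor: a
      defect of orthogonality or a rounding error.\<close>
    define t where "t = ?XU *\<^sub>v c - U\<^sup>T *\<^sub>v f - D\<^sup>T *\<^sub>v (?XV *\<^sub>v e) + G\<^sup>T *\<^sub>v v"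
    have dt [simp]: "dim_vec t = k + 1" by (simp add: t_def)
    have key: "U\<^sup>T *\<^sub>v (U *\<^sub>v c) + U\<^sup>T *\<^sub>v f = D\<^sup>T *\<^sub>v (V\<^sup>T *\<^sub>v v) + G\<^sup>T *\<^sub>v v"
    proof -
      have "U\<^sup>T *\<^sub>v (U *\<^sub>v c) + U\<^sup>T *\<^sub>v f = U\<^sup>T *\<^sub>v (A *\<^sub>v v)" by (simp add: Av mat_vec_add_dim)
      also have "\<dots> = (A\<^sup>T * U)\<^sup>T *\<^sub>v v" by (simp add: transpose_mult_dim mult_mat_vec_assoc_dim)
      also have "\<dots> = D\<^sup>T *\<^sub>v (V\<^sup>T *\<^sub>v v) + G\<^sup>T *\<^sub>v v"
        unfolding AU by (simp add: transpose_add_dim transpose_mult_dim add_mat_vec_dim mult_mat_vec_assoc_dim)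
      finally show ?thesis .
    qed
    have XUc: "?XU *\<^sub>v c = c - U\<^sup>T *\<^sub>v (U *\<^sub>v c)"
      by (simp add: minus_mat_vec_dim one_mat_vec_dim mult_mat_vec_assoc_dim)
    have XVe: "D\<^sup>T *\<^sub>v (?XV *\<^sub>v e) = D\<^sup>T *\<^sub>v e - D\<^sup>T *\<^sub>v (V\<^sup>T *\<^sub>v v)"
      by (simp add: minus_mat_vec_dim one_mat_vec_dim mult_mat_vec_assoc_dim mat_vec_minus_dim e v_def)
    have t: "t $ i = C $$ (i, j) - D $$ (j, i)" if i: "i < k + 1" for i
    proof -
      have "(U\<^sup>T *\<^sub>v (U *\<^sub>v c)) $ i + (U\<^sup>T *\<^sub>v f) $ i = (D\<^sup>T *\<^sub>v (V\<^sup>T *\<^sub>v v)) $ i + (G\<^sup>T *\<^sub>v v) $ i"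
        using arg_cong[OF key, of "\<lambda>x. x $ i"] i by (simp del: index_mult_mat_vec)
      moreover have "(D\<^sup>T *\<^sub>v e) $ i = D $$ (j, i)"
        using i j mat_unit_vec[of j "D\<^sup>T"] by (simp add: e_def)
      moreover have "c $ i = C $$ (i, j)" using i j by (simp add: c_def)
      ultimately show ?thesis unfolding t_def XUc XVe using i by (simp del: index_mult_mat_vec)
    qed
    \<comment> \<open>For \<open>i \<le> j\<close> the entry of \<open>H\<^sup>T\<close> is zero;
      for larger \<open>i\<close> it is the negative of \<open>t $ i\<close>.\<close>
    have "vnorm (col (H\<^sup>T) j) \<le> vnorm t"
    proof (rule vnorm_mono)
      fix i assume "i < dim_vec t"
      then have i: "i < k + 1" by simp
      then show "\<bar>col (H\<^sup>T) j $ i\<bar> \<le> \<bar>t $ i\<bar>"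
        using j H(1)[of j i] H(2)[of j i] by (cases "i \<le> j") (simp_all add: t)
    qed simp
    also have "\<dots> \<le> vnorm (?XU *\<^sub>v c) + vnorm (U\<^sup>T *\<^sub>v f) + vnorm (D\<^sup>T *\<^sub>v (?XV *\<^sub>v e)) + vnorm (G\<^sup>T *\<^sub>v v)"
      unfolding t_def
      by (intro order_trans[OF vnorm_triangle] order_trans[OF vnorm_triangle_minus] add_mono order_refl) simp_all
    also have "\<dots> \<le> (2 * \<mu>) * (4 * M) + 2 * (L * a * r) + (4 * M) * ((2 * \<nu>) * 1) + (L * a * r) * 2"
      by (intro add_mono mnorm_mult_vec_le)
        (use XU(1) XV(1) c4 U2 f1 D4 FG' v2 e in \<open>simp_all add: M_def\<close>)
    also have "\<dots> \<le> 8 * M * (\<mu> + \<nu> + r)"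
    proof -
      have "0 \<le> M * r" using aM a0 FG(4) by simp
      then show ?thesis using r1 by (simp add: algebra_simps)
    qed
    finally show ?thesis .
  qed
  have "mnorm (H\<^sup>T) \<le> sqrt (dim_col (H\<^sup>T)) * (8 * M * (\<mu> + \<nu> + r))"
  proof (rule mnorm_le_sqrt_cols)
    show pos: "0 \<le> 8 * M * (\<mu> + \<nu> + r)" using aM a0 nonneg FG(4) by simp
    fix j assume "j < dim_col (H\<^sup>T)"
    then consider "j < k" | "j = k" by fastforce
    then show "vnorm (col (H\<^sup>T) j) \<le> 8 * M * (\<mu> + \<nu> + r)"
    proof cases
      \<comment> \<open>The recurrence for \<open>A\<close> covers only the first \<open>k\<close>
        columns. The last column of the strictly lower triangular \<open>H\<^sup>T\<close> has no
        entries below the diagonal.\<close>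
      case 2
      have "col (H\<^sup>T) j = 0\<^sub>v (k + 1)" using H(1)[of k] 2 by (intro eq_vecI) simp_all
      then show ?thesis using pos by simp
    qed (rule col)
  qed
  then show "mnorm H \<le> sqrt (k + 1) * (8 * (mnorm A * (1 + L)) * (\<mu> + \<nu> + r))" by (simp add: M_def)
qed

text \<open>The first residual is an exact sum of terms with one small factor each. In the second,
  \<open>A * (P * J)\<close> differs from \<open>U * C\<close> by the small \<open>Y\<close>, and
  \<open>U * C = Q * (S * C)\<close> lies in the range of \<open>Q\<close>, so projecting off that
  range removes it whatever the size of \<open>C\<close>.\<close>

lemma residual_bounds:
  assumes carr: "A \<in> carrier_mat m n" "U \<in> carrier_mat m (k + 1)" "V \<in> carrier_mat n (k + 1)"
      "C \<in> carrier_mat (k + 1) k" "D \<in> carrier_mat (k + 1) (k + 1)" "F \<in> carrier_mat m k"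
      "G \<in> carrier_mat n (k + 1)" "T \<in> carrier_mat (k + 1) (k + 1)" "J \<in> carrier_mat (k + 1) k"
      "Q \<in> carrier_mat m (k + 1)" "P \<in> carrier_mat n (k + 1)" "S \<in> carrier_mat (k + 1) (k + 1)"
    and orth: "Q\<^sup>T * Q = 1\<^sub>m (k + 1)" "P\<^sup>T * P = 1\<^sub>m (k + 1)" "J\<^sup>T * J = 1\<^sub>m k"
    and AV: "A * (V * J) = U * C + F" and AU: "A\<^sup>T * U = V * D + G" and US: "U = Q * S"
    and small: "mnorm (Q - U) \<le> dU" "mnorm (P - V) \<le> dV" "mnorm F \<le> \<phi>" "mnorm G \<le> \<phi>"
      "mnorm D \<le> d" "mnorm (D - T) \<le> h"
  shows "mnorm (P * T - A\<^sup>T * Q) \<le> dV * d + h + \<phi> + mnorm A * dU"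
    and "mnorm (A * (P * J) - Q * (Q\<^sup>T * (A * (P * J)))) \<le> 2 * (mnorm A * dV + \<phi>)"
proof -
  note [simp] = carr[THEN carrier_matD(1)] carr[THEN carrier_matD(2)]
  have P1: "mnorm P \<le> 1" and Q1: "mnorm Q \<le> 1" and J1: "mnorm J \<le> 1"
    using orth by (simp_all add: orthonormal_mnorm)
  have "P * T - A\<^sup>T * Q = (P - V) * D - P * (D - T) - G - A\<^sup>T * (Q - U)"
    by (simp add: minus_mult_dim mult_minus_dim AU) (rule eq_matI; simp del: index_mult_mat(1))
  moreover have "mnorm ((P - V) * D - P * (D - T) - G - A\<^sup>T * (Q - U)) \<le> dV * d + 1 * h + \<phi> + mnorm A * dU"
    by (intro mnorm_minus_le mnorm_mult_le small P1) simp_all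
  ultimately show "mnorm (P * T - A\<^sup>T * Q) \<le> dV * d + h + \<phi> + mnorm A * dU" by simp
  define Y where "Y = A * ((P - V) * J) + F"
  have [simp]: "dim_row Y = m" "dim_col Y = k" by (simp_all add: Y_def)
  have QQ: "Q\<^sup>T * (Q * X) = X" if "dim_row X = k + 1" for X :: "real mat"
    using that orth(1) by (simp add: one_mult_dim flip: mult_assoc_dim)
  have "A * (P * J) = Q * (S * C) + Y"
  proof -
    have "Y = A * (P * J) - (U * C + F) + F"
      unfolding AV[symmetric] by (simp add: Y_def minus_mult_dim mult_minus_dim)
    moreover have "U * C = Q * (S * C)" by (simp add: US mult_assoc_dim)
    ultimately show ?thesis by (simp only:) (rule eq_matI; simp del: index_mult_mat(1))
  qed
  then have "A * (P * J) - Q * (Q\<^sup>T * (A * (P * J))) = (Q * (S * C) + Y) - (Q * (S * C) + Q * (Q\<^sup>T * Y))"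
    by (simp add: mult_add_dim QQ)
  also have "\<dots> = Y - Q * (Q\<^sup>T * Y)"
    by (rule eq_matI; simp del: index_mult_mat(1))
  finally have Z: "A * (P * J) - Q * (Q\<^sup>T * (A * (P * J))) = Y - Q * (Q\<^sup>T * Y)" .
  have Y: "mnorm Y \<le> mnorm A * (dV * 1) + \<phi>"
    unfolding Y_def by (intro mnorm_add_le mnorm_mult_le small J1) simp_all
  have "mnorm (Y - Q * (Q\<^sup>T * Y)) \<le> (mnorm A * (dV * 1) + \<phi>) + 1 * (1 * (mnorm A * (dV * 1) + \<phi>))"
    by (intro mnorm_minus_le mnorm_mult_le Y Q1) (use Q1 in simp_all)
  then show "mnorm (A * (P * J) - Q * (Q\<^sup>T * (A * (P * J)))) \<le> 2 * (mnorm A * dV + \<phi>)"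
    by (simp add: Z algebra_simps)
qed

text \<open>The exact identities hold for all levels below \<open>1 / 2\<close>, whereas the
  estimates are obtained below \<open>1 / 4\<close>. Those thresholds are therefore premises of the
  last conclusion, which concerns the same \<open>Q\<close>, \<open>P\<close> and
  \<open>E\<close>.\<close>

lemma lanczos_backward_error:
  assumes carr: "A \<in> carrier_mat m n" "U \<in> carrier_mat m (k + 1)" "V \<in> carrier_mat n (k + 1)"
      "C \<in> carrier_mat (k + 1) k" "D \<in> carrier_mat (k + 1) (k + 1)" "F \<in> carrier_mat m k"
      "G \<in> carrier_mat n (k + 1)" "T \<in> carrier_mat (k + 1) (k + 1)" "J \<in> carrier_mat (k + 1) k"
    and J: "\<And>j. j < k \<Longrightarrow> col J j = unit_vec (k + 1) j" "J\<^sup>T * J = 1\<^sub>m k"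
    and AV: "A * (V * J) = U * C + F" and AU: "A\<^sup>T * U = V * D + G"
    and T: "\<And>i j. j \<le> k \<Longrightarrow> i \<le> j \<Longrightarrow> D $$ (j, i) = T $$ (j, i)"
      "\<And>i j. j < k \<Longrightarrow> j < i \<Longrightarrow> i \<le> k \<Longrightarrow> C $$ (i, j) = T $$ (j, i)"
    and U1: "vnorm (col U 0) = 1"
    and XU: "mnorm (1\<^sub>m (k + 1) - U\<^sup>T * U) \<le> 2 * \<mu>" "\<mu> < 1 / 2"
    and XV: "mnorm (1\<^sub>m (k + 1) - V\<^sup>T * V) \<le> 2 * \<nu>" "\<nu> < 1 / 2"
    and FG: "mnorm F \<le> L * mnorm A * r" "mnorm G \<le> L * mnorm A * r" "0 \<le> L" "0 \<le> r"
    and kn: "1 \<le> k" "k \<le> n"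
  obtains Q P E where "Q \<in> carrier_mat m (k + 1)" "P \<in> carrier_mat n (k + 1)" "E \<in> carrier_mat m n"
    "Q\<^sup>T * Q = 1\<^sub>m (k + 1)" "P\<^sup>T * P = 1\<^sub>m (k + 1)" "col Q 0 = col U 0"
    "(A + E) * (P * J) = Q * (T\<^sup>T * J)" "(A + E)\<^sup>T * Q = P * T"
    "r \<le> 1 / 4 \<Longrightarrow> \<mu> \<le> 1 / 4 \<Longrightarrow> \<nu> \<le> 1 / 4 \<Longrightarrow>
      mnorm (Q - U) \<le> 2 * (\<mu> + \<mu>\<^sup>2) \<and> mnorm (P - V) \<le> \<nu> + \<nu>\<^sup>2 \<and>
      mnorm E \<le> 28 * (1 + L) * (mnorm A * sqrt n * (k * r + k * \<nu> + \<mu>))"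
proof -
  note [simp] = carr[THEN carrier_matD(1)] carr[THEN carrier_matD(2)]
  obtain Q S where Q: "Q \<in> carrier_mat m (k + 1)" "S \<in> carrier_mat (k + 1) (k + 1)" "Q\<^sup>T * Q = 1\<^sub>m (k + 1)"
    "U = Q * S" "col Q 0 = col U 0" "mnorm (Q - U) \<le> 2 * (1 - sqrt (1 - 2 * \<mu>))"
    using orthonormalize_fixing_first[OF carr(2) _ U1 XU(1)] XU(2) by auto
  obtain P R where P: "P \<in> carrier_mat n (k + 1)" "R \<in> carrier_mat (k + 1) (k + 1)" "P\<^sup>T * P = 1\<^sub>m (k + 1)"
    "V = P * R" "mnorm (R - 1\<^sub>m (k + 1)) \<le> 1 - sqrt (1 - 2 * \<nu>)"
    using polar_factor[OF carr(3) XV(1)] XV(2) by auto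
  note [simp] = P(1,2)[THEN carrier_matD(1)] P(1,2)[THEN carrier_matD(2)]
  have PV: "mnorm (P - V) \<le> 1 - sqrt (1 - 2 * \<nu>)"
  proof -
    have "P - V = (- 1) \<cdot>\<^sub>m (P * (R - 1\<^sub>m (k + 1)))"
      unfolding P(4) by (simp add: mult_minus_dim mult_one_dim) (rule eq_matI; simp del: index_mult_mat(1))
    then have "mnorm (P - V) \<le> mnorm (P * (R - 1\<^sub>m (k + 1)))"
      using mnorm_smult_le[of "- 1" "P * (R - 1\<^sub>m (k + 1))"] by simp
    also have "\<dots> \<le> 1 * (1 - sqrt (1 - 2 * \<nu>))"
      by (intro mnorm_mult_le P(5) orthonormal_mnorm) (use P(3) in simp_all)
    finally show ?thesis by simp
  qed
  obtain E where E: "E \<in> carrier_mat m n" "(A + E) * (P * J) = Q * (T\<^sup>T * J)" "(A + E)\<^sup>T * Q = P * T"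
    "mnorm E \<le> mnorm (P * T - A\<^sup>T * Q) + mnorm (A * (P * J) - Q * (Q\<^sup>T * (A * (P * J))))"
    using backward_error[OF carr(1) Q(1) P(1) carr(8,9) Q(3) P(3) J(2) order_refl order_refl] by metis
  show ?thesis
  proof (rule that[OF Q(1) P(1) E(1) Q(3) P(3) Q(5) E(2,3)])
    assume small: "r \<le> 1 / 4" "\<mu> \<le> 1 / 4" "\<nu> \<le> 1 / 4"
    define a M \<sigma> where "a = mnorm A" and "M = mnorm A * (1 + L)" and "\<sigma> = \<mu> + \<nu> + r"
    have nonneg: "0 \<le> \<mu>" "0 \<le> \<nu>"
      using XU(1) XV(1) mnorm_nonneg[of "1\<^sub>m (k + 1) - U\<^sup>T * U"] mnorm_nonneg[of "1\<^sub>m (k + 1) - V\<^sup>T * V"] by linarith+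
    have a: "0 \<le> a" "a \<le> M" "L * a \<le> M" "0 \<le> M" using FG(3) by (simp_all add: a_def M_def algebra_simps)
    have QU: "mnorm (Q - U) \<le> 2 * (\<mu> + \<mu>\<^sup>2)"
      by (rule order_trans[OF Q(6) mult_left_mono[OF one_minus_sqrt_bound[OF nonneg(1) small(2)]]]) simp
    have PV': "mnorm (P - V) \<le> \<nu> + \<nu>\<^sup>2"
      by (rule order_trans[OF PV one_minus_sqrt_bound[OF nonneg(2) small(3)]])
    have sq: "t\<^sup>2 \<le> t" if "0 \<le> t" "t \<le> 1 / 4" for t :: real
      using mult_left_mono[of t 1 t] that by (simp add: power2_eq_square)
    \<comment> \<open>For the bound on \<open>E\<close> the quadratic terms may be absorbed into the
      linear ones.\<close>
    have QU4: "mnorm (Q - U) \<le> 4 * \<mu>" and PV2: "mnorm (P - V) \<le> 2 * \<nu>"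
      using QU PV' sq[OF nonneg(1) small(2)] sq[OF nonneg(2) small(3)] by simp_all
    have H: "mnorm D \<le> 4 * M" "mnorm (D - T) \<le> sqrt (k + 1) * (8 * M * \<sigma>)"
      unfolding M_def \<sigma>_def
      by (rule reorth_coeff_bound[OF carr(1-7) _ carr(9) J(1) AV AU _ _ XU(1) small(2) XV(1) small(3) FG small(1),
              where H = "D - T"]; use T in \<open>simp add: carrier_matI\<close>)+
    note res = residual_bounds[OF carr Q(1) P(1) Q(2) Q(3) P(3) J(2) AV AU Q(4) QU4 PV2 FG(1,2) H]
    have "mnorm E \<le> 2 * \<nu> * (4 * M) + sqrt (k + 1) * (8 * M * \<sigma>) + L * a * r + a * (4 * \<mu>) + 2 * (a * (2 * \<nu>) + L * a * r)"
      using E(4) res unfolding a_def by linarith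
    also have "\<dots> \<le> 12 * (M * \<sigma>) + 8 * sqrt (k + 1) * (M * \<sigma>)"
    proof -
      have "L * a * r \<le> M * r" "a * \<mu> \<le> M * \<mu>" "a * \<nu> \<le> M * \<nu>" "0 \<le> M * \<mu>" "0 \<le> M * \<nu>" "0 \<le> M * r"
        using a nonneg FG(4) by (auto intro: mult_right_mono)
      moreover have "M * \<sigma> = M * \<mu> + M * \<nu> + M * r" by (simp add: \<sigma>_def algebra_simps)
      moreover have "sqrt (k + 1) * (8 * M * \<sigma>) = 8 * sqrt (k + 1) * (M * \<sigma>)" by simp
      moreover have "2 * \<nu> * (4 * M) = 8 * (M * \<nu>)" "a * (4 * \<mu>) = 4 * (a * \<mu>)"
        "2 * (a * (2 * \<nu>) + L * a * r) = 4 * (a * \<nu>) + 2 * (L * a * r)" by simp_all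
      ultimately show ?thesis by linarith
    qed
    also have "\<dots> \<le> 28 * sqrt n * (M * \<sigma>)"
    proof -
      \<comment> \<open>The bound \<open>4 * n\<close> is chosen for its simple square root; then
        \<open>12 + 8 * 2 = 28\<close> gives the final constant.\<close>
      have "sqrt (k + 1) \<le> sqrt (4 * n)" using kn by (intro real_sqrt_le_mono) linarith
      then have "sqrt (k + 1) \<le> 2 * sqrt n" by (simp add: real_sqrt_mult)
      moreover have "1 \<le> sqrt n" using kn by simp
      ultimately have "12 + 8 * sqrt (k + 1) \<le> 28 * sqrt n" by linarith
      moreover have "0 \<le> M * \<sigma>" using a nonneg FG(4) by (simp add: \<sigma>_def)
      ultimately have "(12 + 8 * sqrt (k + 1)) * (M * \<sigma>) \<le> 28 * sqrt n * (M * \<sigma>)"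
        by (rule mult_right_mono)
      then show ?thesis by (simp add: distrib_right)
    qed
    also have "\<dots> \<le> 28 * sqrt n * (M * (k * r + k * \<nu> + \<mu>))"
    proof -
      \<comment> \<open>The estimate reached so far has no factor \<open>k\<close>; it is introduced
        here, using \<open>1 \<le> k\<close>, to match the claimed form.\<close>
      have "1 * r \<le> k * r" "1 * \<nu> \<le> k * \<nu>" using kn nonneg FG(4) by (intro mult_right_mono; simp)+
      then have "\<sigma> \<le> k * r + k * \<nu> + \<mu>" by (simp add: \<sigma>_def)
      then show ?thesis using a by (intro mult_left_mono) simp_all
    qed
    also have "\<dots> = 28 * (1 + L) * (mnorm A * sqrt n * (k * r + k * \<nu> + \<mu>))"
      by (simp add: M_def)
    finally show "mnorm (Q - U) \<le> 2 * (\<mu> + \<mu>\<^sup>2) \<and> mnorm (P - V) \<le> \<nu> + \<nu>\<^sup>2 \<and>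
      mnorm E \<le> 28 * (1 + L) * (mnorm A * sqrt n * (k * r + k * \<nu> + \<mu>))"
      using QU PV' by blast
  qed
qed

section \<open>From the recurrences to matrices\<close>

lemma dim_cols_mat [simp]: "dim_row (cols_mat m u l) = m" "dim_col (cols_mat m u l) = l"
  by (simp_all add: cols_mat_def)

lemma cols_mat_carrier: "cols_mat m u l \<in> carrier_mat m l"
  by (simp add: carrier_matI)

lemma index_cols_mat [simp]: "i < m \<Longrightarrow> j < l \<Longrightarrow> cols_mat m u l $$ (i, j) = u (Suc j) $ i"
  by (simp add: cols_mat_def mat_of_cols_def del: upt_Suc)

lemma col_cols_mat: "j < l \<Longrightarrow> u (Suc j) \<in> carrier_vec m \<Longrightarrow> col (cols_mat m u l) j = u (Suc j)"
  by (intro eq_vecI) (auto dest: carrier_vecD)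

lemma cols_mat_cols:
  assumes "M \<in> carrier_mat m p" "l \<le> p"
  shows "cols_mat m (\<lambda>i. col M (i - 1)) l = mat m l (\<lambda>(i, j). M $$ (i, j))"
  by (rule eq_matI) (use assms in simp_all)

lemma sum_Suc_shift: "(\<Sum>j = 1..c. g j) = (\<Sum>r = 0..<c. g (Suc r))" for g :: "nat \<Rightarrow> real"
  by (induction c) simp_all

text \<open>Reorthogonalization sums, whose length varies with the column, thus become sums over all
  columns, as in a matrix product.\<close>

lemma sum_prefix:
  fixes g :: "nat \<Rightarrow> real"
  assumes "l \<le> p"
  shows "(\<Sum>r = 0..<p. if r < l then g r else 0) = (\<Sum>r = 0..<l. g r)"
  by (rule sum.mono_neutral_cong_right) (use assms in auto)

text \<open>This is the matrix \<open>J\<close> of the previous section. It turns the passage to the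
  first \<open>k\<close> columns into a multiplication, so that the rules of matrix algebra
  apply.\<close>

definition truncation_mat :: "nat \<Rightarrow> nat \<Rightarrow> real mat" where
  "truncation_mat p k = mat p k (\<lambda>(i, j). if i = j then 1 else 0)"

lemma truncation_mat:
  assumes "k \<le> p"
  shows "truncation_mat p k \<in> carrier_mat p k"
    and "j < k \<Longrightarrow> col (truncation_mat p k) j = unit_vec p j"
    and "(truncation_mat p k)\<^sup>T * truncation_mat p k = 1\<^sub>m k"
    and "M \<in> carrier_mat m p \<Longrightarrow> M * truncation_mat p k = mat m k (\<lambda>(i, j). M $$ (i, j))"
proof -
  show 1: "truncation_mat p k \<in> carrier_mat p k" by (simp add: truncation_mat_def)
  show 2: "col (truncation_mat p k) j = unit_vec p j" if "j < k" for j
    using assms that by (intro eq_vecI) (auto simp: truncation_mat_def unit_vec_def)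
  note [simp] = carrier_matD[OF 1]
  show "(truncation_mat p k)\<^sup>T * truncation_mat p k = 1\<^sub>m k"
    by (rule eq_matI) (use assms in \<open>auto simp: 2\<close>)
  show "M * truncation_mat p k = mat m k (\<lambda>(i, j). M $$ (i, j))" if "M \<in> carrier_mat m p"
    by (rule eq_matI) (use assms that in \<open>auto simp: 2\<close>)
qed

text \<open>This is the matrix \<open>T\<close> of the recurrence for the transpose without
  reorthogonalization and rounding. In 0-based column \<open>c\<close>, the scalar
  \<open>\<beta> (c + 1)\<close> multiplies \<open>v c\<close>, hence its place above the
  diagonal.\<close>

definition ext_bidiag :: "nat \<Rightarrow> (nat \<Rightarrow> real) \<Rightarrow> (nat \<Rightarrow> real) \<Rightarrow> real mat" where
  "ext_bidiag p \<alpha> \<beta> = mat p p (\<lambda>(r, c). if r = c then \<alpha> (c + 1) else if c = r + 1 then \<beta> (c + 1) else 0)"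

lemma ext_bidiag_truncation:
  "(ext_bidiag (k + 1) \<alpha> \<beta>)\<^sup>T * truncation_mat (k + 1) k = bidiag k \<alpha> \<beta>"
  by (subst truncation_mat(4)[of k "k + 1" _ "k + 1"])
    (auto simp: ext_bidiag_def bidiag_def intro!: eq_matI carrier_matI)

text \<open>The first \<open>k\<close> rows of the extended matrix form the transpose of
  \<open>bidiag k \<alpha> \<beta>\<close>. Its last row is \<open>\<alpha> (k + 1)\<close> times a
  unit vector and yields the rank-one term.\<close>

lemma mult_ext_bidiag:
  assumes "P \<in> carrier_mat n (k + 1)"
  shows "P * ext_bidiag (k + 1) \<alpha> \<beta> = (P * truncation_mat (k + 1) k) * (bidiag k \<alpha> \<beta>)\<^sup>T
    + \<alpha> (k + 1) \<cdot>\<^sub>m (mat_of_cols n [col P k] * mat_of_rows (k + 1) [unit_vec (k + 1) k])"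
    (is "_ = _ + ?N")
proof (rule eq_matI)
  note [simp] = assms[THEN carrier_matD(1)] assms[THEN carrier_matD(2)]
  fix i c assume "i < dim_row ((P * truncation_mat (k + 1) k) * (bidiag k \<alpha> \<beta>)\<^sup>T + ?N)"
    "c < dim_col ((P * truncation_mat (k + 1) k) * (bidiag k \<alpha> \<beta>)\<^sup>T + ?N)"
  then have ic: "i < n" "c < k + 1" by simp_all
  have "(P * ext_bidiag (k + 1) \<alpha> \<beta>) $$ (i, c)
      = (\<Sum>r = 0..<k. P $$ (i, r) * bidiag k \<alpha> \<beta> $$ (c, r)) + P $$ (i, k) * (if c = k then \<alpha> (k + 1) else 0)"
    using ic by (auto simp: ext_bidiag_def bidiag_def scalar_prod_def intro!: sum.cong)
  moreover have "P * truncation_mat (Suc k) k = mat n k (\<lambda>(i, j). P $$ (i, j))"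
    using truncation_mat(4)[OF _ assms] by simp
  ultimately show "(P * ext_bidiag (k + 1) \<alpha> \<beta>) $$ (i, c)
      = ((P * truncation_mat (k + 1) k) * (bidiag k \<alpha> \<beta>)\<^sup>T + ?N) $$ (i, c)"
    using ic by (simp add: bidiag_def scalar_prod_def
        mat_of_cols_def mat_of_rows_def unit_vec_def)
qed (use assms in \<open>simp_all add: ext_bidiag_def mat_of_rows_def bidiag_def\<close>)

section \<open>The recurrences in matrix form\<close>

definition left_coeffs :: "nat \<Rightarrow> (nat \<Rightarrow> real) \<Rightarrow> (nat \<Rightarrow> real) \<Rightarrow> (nat \<Rightarrow> nat \<Rightarrow> real) \<Rightarrow> real mat" where
  "left_coeffs k \<alpha> \<beta> \<xi> = mat (k + 1) k (\<lambda>(r, c). bidiag k \<alpha> \<beta> $$ (r, c)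
    + (if r < c + 1 then \<xi> (r + 1) (c + 1) else 0))"

text \<open>The \<eta> part lies strictly above the diagonal, so \<open>H = D - T\<close> is
  strictly upper triangular. The \<xi> part of \<open>left_coeffs\<close> also fills the diagonal
  but leaves the entries below it equal to those of \<open>bidiag\<close>.\<close>

definition right_coeffs :: "nat \<Rightarrow> (nat \<Rightarrow> real) \<Rightarrow> (nat \<Rightarrow> real) \<Rightarrow> (nat \<Rightarrow> nat \<Rightarrow> real) \<Rightarrow> real mat" where
  "right_coeffs p \<alpha> \<beta> \<eta> = mat p p (\<lambda>(r, c). ext_bidiag p \<alpha> \<beta> $$ (r, c)
    + (if r < c then \<eta> (r + 1) (c + 1) else 0))"

lemma lbro_left:
  assumes l: "lbro m n k A b u v \<alpha> \<beta> \<xi> \<eta> f g \<delta>0" and A: "A \<in> carrier_mat m n"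
  shows "A * (cols_mat n v (k + 1) * truncation_mat (k + 1) k)
    = cols_mat m u (k + 1) * left_coeffs k \<alpha> \<beta> \<xi> + cols_mat m f k"
proof (rule eq_matI)
  note [simp] = A[THEN carrier_matD(1)] A[THEN carrier_matD(2)]
  fix i c assume "i < dim_row (cols_mat m u (k + 1) * left_coeffs k \<alpha> \<beta> \<xi> + cols_mat m f k)"
    "c < dim_col (cols_mat m u (k + 1) * left_coeffs k \<alpha> \<beta> \<xi> + cols_mat m f k)"
  then have ic: "i < m" "c < k" by simp_all
  have carr: "u j \<in> carrier_vec m" "v j \<in> carrier_vec n" if "j \<in> {1..k + 1}" for j
    using l that unfolding lbro_def by blast+
  have [simp]: "dim_vec (f (Suc c)) = m" "dim_vec (u (Suc c)) = m" "dim_vec (u (Suc (Suc c))) = m"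
    "dim_vec (v (Suc c)) = n"
    using l ic carr[of "Suc c"] carr[of "Suc (Suc c)"] unfolding lbro_def by (auto dest!: carrier_vecD)
  let ?S = "finsum_vec TYPE(real) m (\<lambda>j. \<xi> j (Suc c) \<cdot>\<^sub>v u j) {1..Suc c}"
  have uc: "(\<lambda>j. \<xi> j (Suc c) \<cdot>\<^sub>v u j) \<in> {1..Suc c} \<rightarrow> carrier_vec m" using carr ic by auto
  have dS: "dim_vec ?S = m" using finsum_vec_closed[OF uc] by (rule carrier_vecD)
  have "?S $ i = (\<Sum>j = 1..Suc c. (\<xi> j (Suc c) \<cdot>\<^sub>v u j) $ i)"
    by (rule index_finsum_vec) (use ic uc in auto)
  also have "\<dots> = (\<Sum>j = 1..Suc c. \<xi> j (Suc c) * u j $ i)"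
    by (intro sum.cong refl index_smult_vec) (use ic carr(1)[THEN carrier_vecD] in auto)
  also have "\<dots> = (\<Sum>r = 0..<k + 1. if r < c + 1 then \<xi> (Suc r) (Suc c) * u (Suc r) $ i else 0)"
    unfolding sum_Suc_shift using ic by (subst sum_prefix) (simp_all del: sum.op_ivl_Suc)
  finally have S: "?S $ i = \<dots>" .
  have "(A *\<^sub>v v (Suc c)) $ i = (\<alpha> (Suc c) \<cdot>\<^sub>v u (Suc c) + \<beta> (Suc c + 1) \<cdot>\<^sub>v u (Suc c + 1) + ?S + f (Suc c)) $ i"
    using l ic unfolding lbro_def by simp
  also have "\<dots> = \<alpha> (Suc c) * u (Suc c) $ i + \<beta> (Suc (Suc c)) * u (Suc (Suc c)) $ i + ?S $ i + f (Suc c) $ i"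
    using ic dS by simp
  also have "\<alpha> (Suc c) * u (Suc c) $ i + \<beta> (Suc (Suc c)) * u (Suc (Suc c)) $ i
      = (\<Sum>r = 0..<k + 1. (if r = c then u (Suc r) $ i * \<alpha> (Suc c) else 0)
        + (if r = c + 1 then u (Suc r) $ i * \<beta> (Suc (Suc c)) else 0))"
    using ic by (simp add: sum.distrib del: sum.op_ivl_Suc)
  finally have "(A *\<^sub>v v (Suc c)) $ i = (\<Sum>r = 0..<k + 1. u (Suc r) $ i * left_coeffs k \<alpha> \<beta> \<xi> $$ (r, c)) + f (Suc c) $ i"
    unfolding S sum.distrib[symmetric]
    using ic by (simp add: left_coeffs_def bidiag_def del: sum.op_ivl_Suc)
      (intro sum.cong refl; simp add: algebra_simps)
  moreover have "(A * (cols_mat n v (k + 1) * truncation_mat (k + 1) k)) $$ (i, c) = (A *\<^sub>v v (Suc c)) $ i"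
    using ic by (simp add: truncation_mat(4)[OF _ cols_mat_carrier] scalar_prod_def)
  moreover have "(cols_mat m u (k + 1) * left_coeffs k \<alpha> \<beta> \<xi> + cols_mat m f k) $$ (i, c)
      = (\<Sum>r = 0..<k + 1. u (Suc r) $ i * left_coeffs k \<alpha> \<beta> \<xi> $$ (r, c)) + f (Suc c) $ i"
    using ic by (simp add: left_coeffs_def scalar_prod_def del: sum.op_ivl_Suc)
  ultimately show "(A * (cols_mat n v (k + 1) * truncation_mat (k + 1) k)) $$ (i, c)
      = (cols_mat m u (k + 1) * left_coeffs k \<alpha> \<beta> \<xi> + cols_mat m f k) $$ (i, c)" by simp
qed (use A in \<open>simp_all add: left_coeffs_def truncation_mat_def\<close>)

lemma lbro_right:
  assumes l: "lbro m n k A b u v \<alpha> \<beta> \<xi> \<eta> f g \<delta>0" and A: "A \<in> carrier_mat m n"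
  shows "A\<^sup>T * cols_mat m u (k + 1) = cols_mat n v (k + 1) * right_coeffs (k + 1) \<alpha> \<beta> \<eta> + cols_mat n g (k + 1)"
proof (rule eq_matI)
  note [simp] = A[THEN carrier_matD(1)] A[THEN carrier_matD(2)]
  fix i c assume "i < dim_row (cols_mat n v (k + 1) * right_coeffs (k + 1) \<alpha> \<beta> \<eta> + cols_mat n g (k + 1))"
    "c < dim_col (cols_mat n v (k + 1) * right_coeffs (k + 1) \<alpha> \<beta> \<eta> + cols_mat n g (k + 1))"
  then have ic: "i < n" "c < k + 1" by simp_all
  have carr: "u j \<in> carrier_vec m" "v j \<in> carrier_vec n" if "j \<in> {1..k + 1}" for j
    using l that unfolding lbro_def by blast+
  have v0: "v 0 = 0\<^sub>v n" using l unfolding lbro_def by blast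
  have vc: "v c \<in> carrier_vec n" using v0 carr(2)[of c] ic by (cases "c = 0") auto
  have [simp]: "dim_vec (g (Suc c)) = n" "dim_vec (v (Suc c)) = n" "dim_vec (v c) = n" "dim_vec (u (Suc c)) = m"
    using l ic carr[of "Suc c"] vc unfolding lbro_def by (auto dest!: carrier_vecD)
  let ?S = "finsum_vec TYPE(real) n (\<lambda>j. \<eta> j (Suc c) \<cdot>\<^sub>v v j) {1..c}"
  have uc: "(\<lambda>j. \<eta> j (Suc c) \<cdot>\<^sub>v v j) \<in> {1..c} \<rightarrow> carrier_vec n" using carr ic by auto
  have dS: "dim_vec ?S = n" using finsum_vec_closed[OF uc] by (rule carrier_vecD)
  have "?S $ i = (\<Sum>j = 1..c. (\<eta> j (Suc c) \<cdot>\<^sub>v v j) $ i)"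
    by (rule index_finsum_vec) (use ic uc in auto)
  also have "\<dots> = (\<Sum>j = 1..c. \<eta> j (Suc c) * v j $ i)"
    by (intro sum.cong refl index_smult_vec) (use ic carr(2)[THEN carrier_vecD] in auto)
  also have "\<dots> = (\<Sum>r = 0..<k + 1. if r < c then \<eta> (Suc r) (Suc c) * v (Suc r) $ i else 0)"
    unfolding sum_Suc_shift using ic by (subst sum_prefix) (simp_all del: sum.op_ivl_Suc)
  finally have S: "?S $ i = \<dots>" .
  have "(A\<^sup>T *\<^sub>v u (Suc c)) $ i = (\<alpha> (Suc c) \<cdot>\<^sub>v v (Suc c) + \<beta> (Suc c) \<cdot>\<^sub>v v (Suc c - 1) +
      finsum_vec TYPE(real) n (\<lambda>j. \<eta> j (Suc c) \<cdot>\<^sub>v v j) {1..Suc c - 1} + g (Suc c)) $ i"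
    using l ic unfolding lbro_def by simp
  also have "\<dots> = \<alpha> (Suc c) * v (Suc c) $ i + \<beta> (Suc c) * v c $ i + ?S $ i + g (Suc c) $ i"
    using ic dS by simp
  \<comment> \<open>For \<open>c = 0\<close> the second sum is empty, which agrees with the
    convention \<open>v 0 = 0\<^sub>v n\<close>.\<close>
  also have "\<alpha> (Suc c) * v (Suc c) $ i + \<beta> (Suc c) * v c $ i
      = (\<Sum>r = 0..<k + 1. (if r = c then v (Suc r) $ i * \<alpha> (Suc c) else 0)
        + (if c = r + 1 then v (Suc r) $ i * \<beta> (Suc c) else 0))"
    using ic v0 by (cases c) (simp_all add: sum.distrib del: sum.op_ivl_Suc)
  finally have "(A\<^sup>T *\<^sub>v u (Suc c)) $ i
      = (\<Sum>r = 0..<k + 1. v (Suc r) $ i * right_coeffs (k + 1) \<alpha> \<beta> \<eta> $$ (r, c)) + g (Suc c) $ i"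
    unfolding S sum.distrib[symmetric]
    using ic by (simp add: right_coeffs_def ext_bidiag_def del: sum.op_ivl_Suc)
      (intro sum.cong refl; simp add: algebra_simps)
  moreover have "(A\<^sup>T * cols_mat m u (k + 1)) $$ (i, c) = (A\<^sup>T *\<^sub>v u (Suc c)) $ i"
    using ic by (simp add: scalar_prod_def)
  moreover have "(cols_mat n v (k + 1) * right_coeffs (k + 1) \<alpha> \<beta> \<eta> + cols_mat n g (k + 1)) $$ (i, c)
      = (\<Sum>r = 0..<k + 1. v (Suc r) $ i * right_coeffs (k + 1) \<alpha> \<beta> \<eta> $$ (r, c)) + g (Suc c) $ i"
    using ic by (simp add: right_coeffs_def scalar_prod_def del: sum.op_ivl_Suc)
  ultimately show "(A\<^sup>T * cols_mat m u (k + 1)) $$ (i, c)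
      = (cols_mat n v (k + 1) * right_coeffs (k + 1) \<alpha> \<beta> \<eta> + cols_mat n g (k + 1)) $$ (i, c)" by simp
qed (use A in \<open>simp_all add: right_coeffs_def\<close>)

text \<open>The witnesses are \<open>28 * (1 + \<bar>K\<bar>)\<close> and \<open>1 / 4\<close>. The
  former comes from the bound on \<open>E\<close> and also covers the quadratic terms and the error
  in \<open>b\<close>. The absolute value allows for any sign of \<open>K\<close>.\<close>

theorem theorem3p3:
  fixes K :: real
  shows "\<exists>C>0. \<exists>\<epsilon>0>0.
    \<forall>(m::nat) (n::nat) (k::nat) (A::real mat) (b::real vec) (rnd::real)
      (u::nat \<Rightarrow> real vec) (v::nat \<Rightarrow> real vec) (\<alpha>::nat \<Rightarrow> real) (\<beta>::nat \<Rightarrow> real)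
      (\<xi>::nat \<Rightarrow> nat \<Rightarrow> real) (\<eta>::nat \<Rightarrow> nat \<Rightarrow> real)
      (f::nat \<Rightarrow> real vec) (g::nat \<Rightarrow> real vec) (\<delta>0::real vec) (\<mu>::real) (\<nu>::real).
      n \<le> m \<longrightarrow> 1 \<le> k \<longrightarrow> k \<le> n \<longrightarrow>
      A \<in> carrier_mat m n \<longrightarrow> b \<in> carrier_vec m \<longrightarrow> b \<noteq> 0\<^sub>v m \<longrightarrow> 0 < rnd \<longrightarrow>
      lbro m n k A b u v \<alpha> \<beta> \<xi> \<eta> f g \<delta>0 \<longrightarrow>
      mnorm (cols_mat m f k) \<le> K * (mnorm A * rnd) \<longrightarrow>
      mnorm (cols_mat n g (k + 1)) \<le> K * (mnorm A * rnd) \<longrightarrow>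
      vnorm \<delta>0 \<le> K * (vnorm b * rnd) \<longrightarrow>
      \<mu> = orth_level (cols_mat m u (k + 1)) \<longrightarrow>
      \<nu> = orth_level (cols_mat n v (k + 1)) \<longrightarrow>
      \<mu> < 1 / 2 \<longrightarrow> \<nu> < 1 / 2 \<longrightarrow>
      (\<exists>(u'::nat \<Rightarrow> real vec) (v'::nat \<Rightarrow> real vec) (E::real mat) (\<delta>b::real vec).
        (\<forall>i\<in>{1..k + 1}. u' i \<in> carrier_vec m) \<and>
        (\<forall>i\<in>{1..k + 1}. v' i \<in> carrier_vec n) \<and>
        E \<in> carrier_mat m n \<and> \<delta>b \<in> carrier_vec m \<and>
        orthonormal_cols (cols_mat m u' (k + 1)) \<and>
        orthonormal_cols (cols_mat n v' (k + 1)) \<and>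
        cols_mat m u' (k + 1) *\<^sub>v (\<beta> 1 \<cdot>\<^sub>v unit_vec (k + 1) 0) = b + \<delta>b \<and>
        (A + E) * cols_mat n v' k = cols_mat m u' (k + 1) * bidiag k \<alpha> \<beta> \<and>
        (A + E)\<^sup>T * cols_mat m u' (k + 1) =
          cols_mat n v' k * (bidiag k \<alpha> \<beta>)\<^sup>T
            + \<alpha> (k + 1) \<cdot>\<^sub>m (mat_of_cols n [v' (k + 1)] * mat_of_rows (k + 1) [unit_vec (k + 1) k]) \<and>
        (rnd \<le> \<epsilon>0 \<and> \<mu> \<le> \<epsilon>0 \<and> \<nu> \<le> \<epsilon>0 \<longrightarrow>
          mnorm (cols_mat m u' (k + 1) - cols_mat m u (k + 1)) \<le> 2 * \<mu> + C * \<mu>\<^sup>2 \<and>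
          mnorm (cols_mat n v' (k + 1) - cols_mat n v (k + 1)) \<le> \<nu> + C * \<nu>\<^sup>2 \<and>
          mnorm E \<le> C * (mnorm A * sqrt (real n) * (real k * rnd + real k * \<nu> + \<mu>)) \<and>
          vnorm \<delta>b \<le> C * (vnorm b * rnd)))"
proof (rule exI[of _ "28 * (1 + \<bar>K\<bar>)"], rule conjI[rotated], rule exI[of _ "1 / 4"], intro conjI allI impI)
  fix m n k A b and rnd :: real and u v \<alpha> \<beta> \<xi> \<eta> f g \<delta>0 \<mu> \<nu>
  assume kn: "1 \<le> k" "k \<le> n" and A: "A \<in> carrier_mat m n" and r0: "0 < rnd"
    and l: "lbro m n k A b u v \<alpha> \<beta> \<xi> \<eta> f g \<delta>0"
    and f: "mnorm (cols_mat m f k) \<le> K * (mnorm A * rnd)"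
    and g: "mnorm (cols_mat n g (k + 1)) \<le> K * (mnorm A * rnd)"
    and \<delta>0: "vnorm \<delta>0 \<le> K * (vnorm b * rnd)"
    and \<mu>: "\<mu> = orth_level (cols_mat m u (k + 1))" "\<mu> < 1 / 2"
    and \<nu>: "\<nu> = orth_level (cols_mat n v (k + 1))" "\<nu> < 1 / 2"
  define U V F G J T where UV: "U = cols_mat m u (k + 1)" "V = cols_mat n v (k + 1)"
      "F = cols_mat m f k" "G = cols_mat n g (k + 1)"
    and JT: "J = truncation_mat (k + 1) k" "T = ext_bidiag (k + 1) \<alpha> \<beta>"
  have u: "u (Suc j) \<in> carrier_vec m" "vnorm (u (Suc j)) = 1"
    and v: "v (Suc j) \<in> carrier_vec n" "vnorm (v (Suc j)) = 1" if "j < k + 1" for j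
    using l that unfolding lbro_def by auto
  have \<delta>0_carr: "\<delta>0 \<in> carrier_vec m" and b: "\<beta> 1 \<cdot>\<^sub>v u 1 = b + \<delta>0" using l unfolding lbro_def by auto
  have XU: "mnorm (1\<^sub>m (k + 1) - U\<^sup>T * U) \<le> 2 * \<mu>"
    using mnorm_le_orth_level[of U] u by (simp add: UV \<mu>(1) col_cols_mat)
  have XV: "mnorm (1\<^sub>m (k + 1) - V\<^sup>T * V) \<le> 2 * \<nu>"
    using mnorm_le_orth_level[of V] v by (simp add: UV \<nu>(1) col_cols_mat)
  have scale: "K * (x * rnd) \<le> \<bar>K\<bar> * x * rnd" if "0 \<le> x" for x
    using that r0 by (simp add: mult_right_mono flip: mult.assoc)
  have FG: "mnorm F \<le> \<bar>K\<bar> * mnorm A * rnd" "mnorm G \<le> \<bar>K\<bar> * mnorm A * rnd"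
    using f g scale[of "mnorm A"] by (simp_all add: UV)
  have "U \<in> carrier_mat m (k + 1)" "V \<in> carrier_mat n (k + 1)" "F \<in> carrier_mat m k" "G \<in> carrier_mat n (k + 1)"
    by (simp_all add: UV cols_mat_carrier)
  note UVFG = this
  have CD: "left_coeffs k \<alpha> \<beta> \<xi> \<in> carrier_mat (k + 1) k" "right_coeffs (k + 1) \<alpha> \<beta> \<eta> \<in> carrier_mat (k + 1) (k + 1)"
    by (simp_all add: left_coeffs_def right_coeffs_def)
  have T: "T \<in> carrier_mat (k + 1) (k + 1)" by (simp add: JT ext_bidiag_def)
  have J: "J \<in> carrier_mat (k + 1) k" by (simp add: JT truncation_mat)
  have col0: "col U 0 = u 1" using col_cols_mat[of 0 "k + 1" u m] u[of 0] by (simp add: UV)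
  obtain Q P E where Q: "Q \<in> carrier_mat m (k + 1)" and P: "P \<in> carrier_mat n (k + 1)" and E: "E \<in> carrier_mat m n"
    and orth: "Q\<^sup>T * Q = 1\<^sub>m (k + 1)" "P\<^sup>T * P = 1\<^sub>m (k + 1)" and Q0: "col Q 0 = col U 0"
    and AE: "(A + E) * (P * J) = Q * (T\<^sup>T * J)" "(A + E)\<^sup>T * Q = P * T"
    and bounds: "rnd \<le> 1 / 4 \<Longrightarrow> \<mu> \<le> 1 / 4 \<Longrightarrow> \<nu> \<le> 1 / 4 \<Longrightarrow>
      mnorm (Q - U) \<le> 2 * (\<mu> + \<mu>\<^sup>2) \<and> mnorm (P - V) \<le> \<nu> + \<nu>\<^sup>2 \<and>
      mnorm E \<le> 28 * (1 + \<bar>K\<bar>) * (mnorm A * sqrt n * (k * rnd + k * \<nu> + \<mu>))"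
  proof (rule lanczos_backward_error[OF A UVFG(1,2) CD UVFG(3,4) T J _ _ _ _ _ _ _ XU \<mu>(2) XV \<nu>(2) FG _ _ kn])
    show "A * (V * J) = U * left_coeffs k \<alpha> \<beta> \<xi> + F" using lbro_left[OF l A] by (simp add: UV JT)
    show "A\<^sup>T * U = V * right_coeffs (k + 1) \<alpha> \<beta> \<eta> + G" using lbro_right[OF l A] by (simp add: UV)
    show "vnorm (col U 0) = 1" using u[of 0] by (simp add: col0)
  qed (use r0 in \<open>auto simp: JT truncation_mat left_coeffs_def right_coeffs_def bidiag_def ext_bidiag_def\<close>)
  \<comment> \<open>The sequences start at index 1, the columns of \<open>Q\<close> and
    \<open>P\<close> at 0.\<close>
  define u' v' where u': "u' = (\<lambda>i. col Q (i - 1))" and v': "v' = (\<lambda>i. col P (i - 1))"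
  have Qu: "cols_mat m u' (k + 1) = Q" and Pv: "cols_mat n v' (k + 1) = P"
    unfolding u' v' cols_mat_cols[OF Q order_refl] cols_mat_cols[OF P order_refl]
    by (rule eq_matI; use Q P in simp)+
  have Pvk: "cols_mat n v' k = P * J"
    unfolding v' JT truncation_mat(4)[OF le_add1 P] by (rule cols_mat_cols[OF P]) simp
  show "\<exists>u' v' E \<delta>b.
      (\<forall>i\<in>{1..k + 1}. u' i \<in> carrier_vec m) \<and> (\<forall>i\<in>{1..k + 1}. v' i \<in> carrier_vec n) \<and>
      E \<in> carrier_mat m n \<and> \<delta>b \<in> carrier_vec m \<and>
      orthonormal_cols (cols_mat m u' (k + 1)) \<and> orthonormal_cols (cols_mat n v' (k + 1)) \<and>
      cols_mat m u' (k + 1) *\<^sub>v (\<beta> 1 \<cdot>\<^sub>v unit_vec (k + 1) 0) = b + \<delta>b \<and>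
      (A + E) * cols_mat n v' k = cols_mat m u' (k + 1) * bidiag k \<alpha> \<beta> \<and>
      (A + E)\<^sup>T * cols_mat m u' (k + 1) =
        cols_mat n v' k * (bidiag k \<alpha> \<beta>)\<^sup>T
          + \<alpha> (k + 1) \<cdot>\<^sub>m (mat_of_cols n [v' (k + 1)] * mat_of_rows (k + 1) [unit_vec (k + 1) k]) \<and>
      (rnd \<le> 1 / 4 \<and> \<mu> \<le> 1 / 4 \<and> \<nu> \<le> 1 / 4 \<longrightarrow>
        mnorm (cols_mat m u' (k + 1) - cols_mat m u (k + 1)) \<le> 2 * \<mu> + 28 * (1 + \<bar>K\<bar>) * \<mu>\<^sup>2 \<and>
        mnorm (cols_mat n v' (k + 1) - cols_mat n v (k + 1)) \<le> \<nu> + 28 * (1 + \<bar>K\<bar>) * \<nu>\<^sup>2 \<and>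
        mnorm E \<le> 28 * (1 + \<bar>K\<bar>) * (mnorm A * sqrt (real n) * (real k * rnd + real k * \<nu> + \<mu>)) \<and>
        vnorm \<delta>b \<le> 28 * (1 + \<bar>K\<bar>) * (vnorm b * rnd))"
  proof (rule exI[of _ u'], rule exI[of _ v'], rule exI[of _ E], rule exI[of _ \<delta>0], intro conjI impI)
    show "\<forall>i\<in>{1..k + 1}. u' i \<in> carrier_vec m" "\<forall>i\<in>{1..k + 1}. v' i \<in> carrier_vec n"
      using Q P by (auto simp: u' v' intro!: carrier_vecI)
    show "E \<in> carrier_mat m n" "\<delta>0 \<in> carrier_vec m" by (rule E, rule \<delta>0_carr)
    show "orthonormal_cols (cols_mat m u' (k + 1))" "orthonormal_cols (cols_mat n v' (k + 1))"
      using Q P orth by (simp_all only: Qu Pv orthonormal_cols_def carrier_matD)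
    \<comment> \<open>Since \<open>Q\<close> keeps the first column \<open>u 1\<close>, the error in
      \<open>b\<close> is exactly the initial rounding error \<open>\<delta>0\<close>, free of
      orthogonality levels.\<close>
    have "Q *\<^sub>v (\<beta> 1 \<cdot>\<^sub>v unit_vec (k + 1) 0) = \<beta> 1 \<cdot>\<^sub>v col Q 0"
      using mat_unit_vec[of 0 Q] carrier_matD[OF Q] by (simp add: mat_vec_smult_dim)
    then show "cols_mat m u' (k + 1) *\<^sub>v (\<beta> 1 \<cdot>\<^sub>v unit_vec (k + 1) 0) = b + \<delta>0"
      by (simp add: Qu Q0 col0 b del: One_nat_def)
    show "(A + E) * cols_mat n v' k = cols_mat m u' (k + 1) * bidiag k \<alpha> \<beta>"
      unfolding Qu Pvk AE unfolding JT ext_bidiag_truncation ..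
    show "(A + E)\<^sup>T * cols_mat m u' (k + 1) = cols_mat n v' k * (bidiag k \<alpha> \<beta>)\<^sup>T
        + \<alpha> (k + 1) \<cdot>\<^sub>m (mat_of_cols n [v' (k + 1)] * mat_of_rows (k + 1) [unit_vec (k + 1) k])"
      unfolding Qu Pvk AE unfolding JT mult_ext_bidiag[OF P] by (simp add: v')
    assume "rnd \<le> 1 / 4 \<and> \<mu> \<le> 1 / 4 \<and> \<nu> \<le> 1 / 4"
    then have bds: "mnorm (Q - U) \<le> 2 * (\<mu> + \<mu>\<^sup>2)" "mnorm (P - V) \<le> \<nu> + \<nu>\<^sup>2"
      "mnorm E \<le> 28 * (1 + \<bar>K\<bar>) * (mnorm A * sqrt n * (k * rnd + k * \<nu> + \<mu>))"
      using bounds by auto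
    have C: "c * x\<^sup>2 \<le> 28 * (1 + \<bar>K\<bar>) * x\<^sup>2" if "c \<le> 28" for c x :: real
      using that by (intro mult_right_mono) auto
    show "mnorm (cols_mat m u' (k + 1) - cols_mat m u (k + 1)) \<le> 2 * \<mu> + 28 * (1 + \<bar>K\<bar>) * \<mu>\<^sup>2"
      using bds(1) C[of 2 \<mu>] by (simp only: Qu flip: UV) argo
    show "mnorm (cols_mat n v' (k + 1) - cols_mat n v (k + 1)) \<le> \<nu> + 28 * (1 + \<bar>K\<bar>) * \<nu>\<^sup>2"
      using bds(2) C[of 1 \<nu>] by (simp only: Pv flip: UV) argo
    show "mnorm E \<le> 28 * (1 + \<bar>K\<bar>) * (mnorm A * sqrt (real n) * (real k * rnd + real k * \<nu> + \<mu>))"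
      by (rule bds)
    have "\<bar>K\<bar> * (vnorm b * rnd) \<le> 28 * (1 + \<bar>K\<bar>) * (vnorm b * rnd)"
      using r0 by (intro mult_right_mono) auto
    then show "vnorm \<delta>0 \<le> 28 * (1 + \<bar>K\<bar>) * (vnorm b * rnd)"
      using \<delta>0 scale[of "vnorm b"] by (simp add: mult.assoc)
  qed
qed auto

end
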